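(* Let $k\in\mathbb N$, $0<\alpha\le1$ and $f\in\mathcal C^{k,\alpha}(\mathbb S^2)$. Then $\sum_{n\in\mathbb Z^2}|c_n(\tilde f)|<\infty$, the Fourier series of $\tilde f$ converges to $\tilde f$ uniformly on $\mathbb T^2$ (along any expanding sequence of bounded sets exhausting $\mathbb Z^2$), and for every finite $\Omega\subset\mathbb Z^2$, $$\|\tilde f-F_\Omega\tilde f\|_{\mathcal C(\mathbb T^2)}\le\sum_{n\in\mathbb Z^2\setminus\Omega}|c_n(\tilde f)|.$$ Further, the DFS Fourier series of $f$ converges to $f$ uniformly on $\mathbb S^2$ (along any expanding sequence of bounded sets exhausting $\mathbb Z\times\mathbb N_0$), and for every finite $\Omega\subset\mathbb Z\times\mathbb N_0$, $$\|f-S_\Omega f\|_{\mathcal C(\mathbb S^2)}\le\sum_{n\in\mathbb Z^2\setminus\tilde\Omega}|c_n(\tilde f)|,\qquad \tilde\Omega:=\Omega\cup M(\Omega).$$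
   Context: Notation: $\|\cdot\|$ Euclidean norm; $B^d_k:=\{\beta\in\mathbb N_0^d: |\beta|=\sum_i\beta_i\le k\}$. For open $U\subset\mathbb R^d$: $\mathcal C^k(U)$ the bounded uniformly continuous complex functions whose classical derivatives $D^\beta f$, $\beta\in B^d_k$, are bounded and uniformly continuous; for $0<\alpha<1$, $\mathcal C^{k,\alpha}(U)$ those $f\in\mathcal C^k(U)$ with $\sup\{|D^\beta f(x)-D^\beta f(y)|/\|x-y\|^\alpha: x\ne y,|\beta|=k\}<\infty$. Sphere: for $0\le\alpha<1$, $f\colon\mathbb S^2\to\mathbb C$ is in $\mathcal C^{k,\alpha}(\mathbb S^2)$ iff the infimum, over all $f^*\in\mathcal C^{k,\alpha}(U)$ with $U\supset\mathbb S^2$ open and $f^*|_{\mathbb S^2}=f$ ($\mathcal C^{k,0}=\mathcal C^k$), of $\sum_{\beta\in B^3_k}\sup_{\mathbb S^2}|D^\beta f^*|$ plus (if $\alpha>0$) $\sup\{|D^\beta f^*(\xi)-D^\beta f^*(\eta)|/\|\xi-\eta\|^\alpha:\xi\ne\eta\in\mathbb S^2,|\beta|=k\}$ is finite. Convention: $\mathcal C^{k,1}(\mathbb S^2):=\mathcal C^{k+1}(\mathbb S^2)$. $\mathbb T^2=\mathbb R^2/(2\pi\mathbb Z^2)$; $\|g\|_{\mathcal C(X)}=\sup_X|g|$. $\phi(\lambda,\theta)=(\cos\lambda\sin\theta,\sin\lambda\sin\theta,\cos\theta)$, DFS function $\tilde f=f\circ\phi$; $\phi^{-1}$ is the inverse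 of the restriction of $\phi$ to $[-\pi,\pi)\times(0,\pi)\cup\{(0,0),(0,\pi)\}$. $c_n(g)=(2\pi)^{-2}\int_{\mathbb T^2}g(x)e^{-i\langle n,x\rangle}dx$, $F_\Omega g(x)=\sum_{n\in\Omega}c_n(g)e^{i\langle n,x\rangle}$. $M(n_1,n_2)=(n_1,-n_2)$; $e_n(x)=e^{i\langle n,x\rangle}+(-1)^{n_1}e^{i\langle M(n),x\rangle}$ if $n_2\ne0$, $e_n(x)=e^{i\langle n,x\rangle}$ if $n_2=0$; $b_n=e_n\circ\phi^{-1}$ for $n\in\mathbb Z\times\mathbb N_0$; $S_\Omega f(\xi)=\sum_{n\in\Omega}c_n(\tilde f)b_n(\xi)$, and the DFS Fourier series is $\lim_h S_{\Omega_h}f$ for expanding bounded $\Omega_h$ exhausting $\mathbb Z\times\mathbb N_0$. *)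

theory Defs
  imports "HOL-Analysis.Analysis"
begin

definition pdiff :: "3 \<Rightarrow> (real^3 \<Rightarrow> complex) \<Rightarrow> real^3 \<Rightarrow> complex" where
  "pdiff i g x = vector_derivative (\<lambda>t::real. g (x + t *\<^sub>R axis i 1)) (at 0)"

definition Dw :: "3 list \<Rightarrow> (real^3 \<Rightarrow> complex) \<Rightarrow> real^3 \<Rightarrow> complex" where
  "Dw ds g = foldr pdiff ds g"

definition Ck_open :: "nat \<Rightarrow> (real^3) set \<Rightarrow> (real^3 \<Rightarrow> complex) \<Rightarrow> bool" where
  "Ck_open k U g \<longleftrightarrow>
     (\<forall>ds. length ds < k \<longrightarrow> (\<forall>i. \<forall>x\<in>U.
         (\<lambda>t::real. Dw ds g (x + t *\<^sub>R axis i 1)) differentiable (at 0))) \<and>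
     (\<forall>ds. length ds \<le> k \<longrightarrow>
         bounded (Dw ds g ` U) \<and> uniformly_continuous_on U (Dw ds g))"

definition Ckalpha_open :: "nat \<Rightarrow> real \<Rightarrow> (real^3) set \<Rightarrow> (real^3 \<Rightarrow> complex) \<Rightarrow> bool" where
  "Ckalpha_open k \<alpha> U g \<longleftrightarrow> Ck_open k U g \<and>
     (\<exists>C. \<forall>ds. length ds = k \<longrightarrow> (\<forall>x\<in>U. \<forall>y\<in>U. x \<noteq> y \<longrightarrow>
         norm (Dw ds g x - Dw ds g y) \<le> C * dist x y powr \<alpha>))"

abbreviation S2 :: "(real^3) set" where "S2 \<equiv> sphere 0 1"

text \<open>C^{k,alpha}(S^2) for 0 \<le> alpha < 1 (alpha = 0 meaning C^k): existence of an
  extension in C^{k,alpha}(U) for some open U \<supseteq> S^2 (the norm in the paper is then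
  automatically finite).  Convention C^{k,1}(S^2) = C^{k+1}(S^2).\<close>
definition Ckalpha_sphere :: "nat \<Rightarrow> real \<Rightarrow> (real^3 \<Rightarrow> complex) \<Rightarrow> bool" where
  "Ckalpha_sphere k \<alpha> f \<longleftrightarrow>
     (if \<alpha> = 1 then
        (\<exists>U g. open U \<and> S2 \<subseteq> U \<and> Ck_open (k+1) U g \<and> (\<forall>\<xi>\<in>S2. g \<xi> = f \<xi>))
      else if \<alpha> = 0 then
        (\<exists>U g. open U \<and> S2 \<subseteq> U \<and> Ck_open k U g \<and> (\<forall>\<xi>\<in>S2. g \<xi> = f \<xi>))
      else
        (\<exists>U g. open U \<and> S2 \<subseteq> U \<and> Ckalpha_open k \<alpha> U g \<and> (\<forall>\<xi>\<in>S2. g \<xi> = f \<xi>)))"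

definition phi :: "real \<times> real \<Rightarrow> real^3" where
  "phi p = (case p of (lam, \<theta>) \<Rightarrow>
     (\<chi> i. if i = 1 then cos lam * sin \<theta> else if i = 2 then sin lam * sin \<theta> else cos \<theta>))"

definition phi_dom :: "(real \<times> real) set" where
  "phi_dom = ({-pi..<pi} \<times> {0<..<pi}) \<union> {(0,0), (0,pi)}"

definition phi_inv :: "real^3 \<Rightarrow> real \<times> real" where
  "phi_inv \<xi> = (THE p. p \<in> phi_dom \<and> phi p = \<xi>)"

definition dfs :: "(real^3 \<Rightarrow> complex) \<Rightarrow> real \<times> real \<Rightarrow> complex" where
  "dfs f = f \<circ> phi"

definition ip :: "int \<times> int \<Rightarrow> real \<times> real \<Rightarrow> real" where
  "ip n x = of_int (fst n) * fst x + of_int (snd n) * snd x"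

text \<open>Fourier coefficients on T^2 = R^2/(2 pi Z^2), for 2pi-periodic g.\<close>
definition fcoeff :: "int \<times> int \<Rightarrow> (real \<times> real \<Rightarrow> complex) \<Rightarrow> complex" where
  "fcoeff n g = complex_of_real (1 / (2*pi)^2) *
     integral (cbox (0,0) (2*pi, 2*pi)) (\<lambda>x. g x * exp (- \<i> * complex_of_real (ip n x)))"

definition Fpart :: "(int \<times> int) set \<Rightarrow> (real \<times> real \<Rightarrow> complex) \<Rightarrow> real \<times> real \<Rightarrow> complex" where
  "Fpart \<Omega> g x = (\<Sum>n\<in>\<Omega>. fcoeff n g * exp (\<i> * complex_of_real (ip n x)))"

definition Mref :: "int \<times> int \<Rightarrow> int \<times> int" where
  "Mref n = (fst n, - snd n)"

definition en :: "int \<times> int \<Rightarrow> real \<times> real \<Rightarrow> complex" where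
  "en n x = (if snd n \<noteq> 0
     then exp (\<i> * complex_of_real (ip n x))
          + (-1) ^ nat \<bar>fst n\<bar> * exp (\<i> * complex_of_real (ip (Mref n) x))
     else exp (\<i> * complex_of_real (ip n x)))"

definition bn :: "int \<times> int \<Rightarrow> real^3 \<Rightarrow> complex" where
  "bn n = en n \<circ> phi_inv"

definition Spart :: "(int \<times> int) set \<Rightarrow> (real^3 \<Rightarrow> complex) \<Rightarrow> real^3 \<Rightarrow> complex" where
  "Spart \<Omega> f \<xi> = (\<Sum>n\<in>\<Omega>. fcoeff n (dfs f) * bn n \<xi>)"

definition ZN0 :: "(int \<times> int) set" where
  "ZN0 = {n. snd n \<ge> 0}"

end

theory Submission
  imports Defs
begin

text \<open>
  The DFS function \<open>f \<circ> \<phi>\<close> inherits from \<open>f\<close> a bound \<open>O(t^(1+\<beta>))\<close>, \<open>\<beta> > 0\<close>, for its second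
  differences of step \<open>t\<close> in each coordinate. Such a difference multiplies \<open>c\<^sub>n\<close> by
  \<open>2 cos(n\<^sub>j t) - 2\<close>, so Bessel's inequality and Cauchy-Schwarz on dyadic shells give absolute
  summability (Bernstein's argument), without differentiating under the integral.
  Since \<open>\<phi>\<close> has trigonometric components, Stone-Weierstrass on the sphere makes \<open>f \<circ> \<phi>\<close> a uniform
  limit of trigonometric polynomials; a function of this kind is determined by its Fourier
  coefficients, hence the series converges to \<open>f \<circ> \<phi>\<close>. Translation and reflection rules for
  Fourier coefficients are checked on exponentials and passed to the limit. Finally
  \<open>\<phi> (\<lambda> + \<pi>, - \<theta>) = \<phi> (\<lambda>, \<theta>)\<close> gives \<open>c\<^sub>M\<^sub>n = (-1)^n\<^sub>1 c\<^sub>n\<close>, which identifies the partial sums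
  on the sphere with partial sums on the torus over \<open>\<Omega> \<union> M(\<Omega>)\<close>.
\<close>

section \<open>Means and Fourier coefficients on the torus\<close>

definition fexp :: "int \<times> int \<Rightarrow> real \<times> real \<Rightarrow> complex" where
  "fexp n x = exp (\<i> * complex_of_real (ip n x))"

lemma fexp_0 [simp]: "fexp 0 x = 1"
  by (simp add: fexp_def ip_def)

lemma fexp_mult: "fexp n x * fexp m x = fexp (n + m) x"
  by (simp add: fexp_def ip_def exp_add [symmetric] algebra_simps)

lemma fexp_add_arg: "fexp n (x + y) = fexp n x * fexp n y"
  by (simp add: fexp_def ip_def exp_add [symmetric] algebra_simps)

lemma cnj_fexp: "cnj (fexp n x) = fexp (- n) x"
  by (simp add: fexp_def ip_def exp_cnj algebra_simps)

lemma norm_fexp [simp]: "norm (fexp n x) = 1"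
  by (simp add: fexp_def)

lemma continuous_on_fexp [continuous_intros]: "continuous_on S (fexp n)"
  unfolding fexp_def ip_def by (intro continuous_intros)

text \<open>Normalised to give the constant 1 mean 1, so that \<open>fcoeff n g\<close> is the plain
  mean of \<open>g\<close> times \<open>fexp (- n)\<close>.\<close>

definition tmean :: "(real \<times> real \<Rightarrow> complex) \<Rightarrow> complex" where
  "tmean g = complex_of_real (1 / (2*pi)^2) * integral (cbox (0,0) (2*pi, 2*pi)) g"

lemma fcoeff_eq_tmean: "fcoeff n g = tmean (\<lambda>x. g x * fexp (- n) x)"
  by (simp add: fcoeff_def tmean_def fexp_def ip_def algebra_simps)

lemma integrable_on_torus:
  fixes g :: "real \<times> real \<Rightarrow> complex"
  assumes "continuous_on UNIV g"
  shows "g integrable_on cbox (0,0) (2*pi, 2*pi)"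
  using assms continuous_on_subset integrable_continuous by blast

lemma tmean_add:
  assumes "continuous_on UNIV g" "continuous_on UNIV h"
  shows "tmean (\<lambda>x. g x + h x) = tmean g + tmean h"
  by (simp add: tmean_def Henstock_Kurzweil_Integration.integral_add integrable_on_torus assms
      distrib_left add_divide_distrib)

lemma tmean_diff:
  assumes "continuous_on UNIV g" "continuous_on UNIV h"
  shows "tmean (\<lambda>x. g x - h x) = tmean g - tmean h"
  by (simp add: tmean_def Henstock_Kurzweil_Integration.integral_diff integrable_on_torus assms
      right_diff_distrib diff_divide_distrib)

lemma tmean_cmult: "tmean (\<lambda>x. c * g x) = c * tmean g"
  by (simp add: tmean_def)

lemma tmean_sum:
  assumes "\<And>i. i \<in> I \<Longrightarrow> continuous_on UNIV (g i)"
  shows "tmean (\<lambda>x. \<Sum>i\<in>I. g i x) = (\<Sum>i\<in>I. tmean (g i))"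
proof (cases "finite I")
  case True
  then show ?thesis
    by (simp add: tmean_def Henstock_Kurzweil_Integration.integral_sum integrable_on_torus assms
        sum_distrib_left)
qed (simp add: tmean_def)

lemma content_torus: "measure lborel (cbox (0::real,0::real) (2*pi, 2*pi)) = (2*pi)^2"
  by (simp add: content_Pair power2_eq_square)

lemma norm_tmean_le:
  assumes "continuous_on UNIV g" and B: "\<And>x. norm (g x) \<le> B"
  shows "norm (tmean g) \<le> B"
proof -
  have "0 \<le> B" using B [of 0] norm_ge_zero order_trans by blast
  then have "norm (integral (cbox (0,0) (2*pi, 2*pi)) g) \<le> B * (2*pi)^2"
    using has_integral_bound [of B g _ "(0,0)" "(2*pi, 2*pi)"] integrable_on_torus [OF assms(1)] B
      content_torus by (metis integrable_integral)
  then show ?thesis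
    by (simp add: tmean_def norm_mult norm_divide norm_power field_simps)
qed

text \<open>Fubini factors the integral over the square into two one-dimensional ones; a factor of
  nonzero frequency vanishes because its antiderivative is 2 pi periodic.\<close>

lemma tmean_fexp: "tmean (fexp n) = (if n = 0 then 1 else 0)"
proof (cases "n = 0")
  case True
  then have "fexp n = (\<lambda>x. 1)" by auto
  then show ?thesis
    using content_torus True by (simp add: tmean_def power2_eq_square scaleR_conv_of_real)
next
  case False
  define e where "e k t = exp (\<i> * complex_of_real (of_int k * t))" for k :: int and t :: real
  have e: "integral {0..2*pi} (e k) = 0" if "k \<noteq> 0" for k
  proof -
    define c where "c = \<i> * complex_of_int k"
    have c: "c \<noteq> 0" using that by (simp add: c_def)
    have ec: "e k t = exp (c * complex_of_real t)" for t
      by (simp add: e_def c_def mult_ac)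
    have "(e k has_integral (e k (2*pi) / c - e k 0 / c)) {0..2*pi}"
    proof (rule fundamental_theorem_of_calculus)
      fix x :: real
      have "((\<lambda>z. exp (c * z) / c) has_field_derivative exp (c * of_real x)) (at (of_real x))"
        using c by (auto intro!: derivative_eq_intros)
      then show "((\<lambda>a. e k a / c) has_vector_derivative e k x) (at x within {0..2*pi})"
        unfolding ec by (rule has_vector_derivative_real_field)
    qed simp
    moreover have "e k (2*pi) = 1"
    proof -
      have "\<i> * complex_of_real (of_int k * (2*pi)) = complex_of_real (2 * of_int k * pi) * \<i>"
        by (simp add: algebra_simps)
      then show ?thesis using exp_integer_2pi [OF Ints_of_int [of k]] by (simp only: e_def)
    qed
    ultimately show ?thesis by (simp add: e_def integral_unique)
  qed
  have "integral (cbox (0,0) (2*pi, 2*pi)) (fexp n)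
      = integral {0..2*pi} (\<lambda>x. integral {0..2*pi} (\<lambda>y. fexp n (x, y)))"
    using integral_prod_continuous [OF continuous_on_fexp, of 0 0 "2*pi" "2*pi" n] by simp
  also have "\<dots> = integral {0..2*pi} (\<lambda>x. integral {0..2*pi} (\<lambda>y. e (fst n) x * e (snd n) y))"
    by (simp add: e_def fexp_def ip_def exp_add [symmetric] algebra_simps)
  also have "\<dots> = integral {0..2*pi} (e (fst n)) * integral {0..2*pi} (e (snd n))"
    by simp
  also have "\<dots> = 0" using False e by (auto simp: prod_eq_iff)
  finally show ?thesis using False by (simp add: tmean_def)
qed

lemma fcoeff_fexp: "fcoeff m (fexp n) = (if m = n then 1 else 0)"
  using tmean_fexp [of "n - m"] by (auto simp: fcoeff_eq_tmean fexp_mult)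

section \<open>Linearity of Fourier coefficients, orthogonality and Bessel's inequality\<close>

lemma fcoeff_add:
  assumes "continuous_on UNIV g" "continuous_on UNIV h"
  shows "fcoeff n (\<lambda>x. g x + h x) = fcoeff n g + fcoeff n h"
  unfolding fcoeff_eq_tmean distrib_right
  by (intro tmean_add continuous_intros assms)

lemma fcoeff_diff:
  assumes "continuous_on UNIV g" "continuous_on UNIV h"
  shows "fcoeff n (\<lambda>x. g x - h x) = fcoeff n g - fcoeff n h"
  unfolding fcoeff_eq_tmean left_diff_distrib
  by (intro tmean_diff continuous_intros assms)

lemma fcoeff_cmult: "fcoeff n (\<lambda>x. c * g x) = c * fcoeff n g"
  by (simp add: fcoeff_eq_tmean mult.assoc tmean_cmult)

lemma norm_fcoeff_le:
  assumes "continuous_on UNIV g" "\<And>x. norm (g x) \<le> B"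
  shows "norm (fcoeff n g) \<le> B"
  unfolding fcoeff_eq_tmean
  by (rule norm_tmean_le) (auto intro!: continuous_intros assms simp: norm_mult)

lemma Fpart_eq: "Fpart \<Omega> g = (\<lambda>x. \<Sum>n\<in>\<Omega>. fcoeff n g * fexp n x)"
  by (simp add: Fpart_def fexp_def fun_eq_iff)

lemma fcoeff_fexp_sum:
  assumes "finite \<Omega>" "n \<in> \<Omega>"
  shows "fcoeff n (\<lambda>x. \<Sum>m\<in>\<Omega>. c m * fexp m x) = c n"
proof -
  have "fcoeff n (\<lambda>x. \<Sum>m\<in>\<Omega>. c m * fexp m x) = tmean (\<lambda>x. \<Sum>m\<in>\<Omega>. c m * (fexp m x * fexp (- n) x))"
    by (simp add: fcoeff_eq_tmean sum_distrib_right mult.assoc)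
  also have "\<dots> = (\<Sum>m\<in>\<Omega>. tmean (\<lambda>x. c m * (fexp m x * fexp (- n) x)))"
    by (intro tmean_sum continuous_intros)
  also have "\<dots> = (\<Sum>m\<in>\<Omega>. if m = n then c m else 0)"
    unfolding tmean_cmult fcoeff_eq_tmean [symmetric] fcoeff_fexp by (intro sum.cong) auto
  finally show ?thesis using assms by simp
qed

text \<open>Expand the mean of \<open>|g - F\<^sub>\<Omega> g|\<^sup>2 \<ge> 0\<close>.\<close>
lemma Bessel:
  assumes g: "continuous_on UNIV g" and B: "\<And>x. norm (g x) \<le> B" and "finite \<Omega>"
  shows "(\<Sum>n\<in>\<Omega>. (norm (fcoeff n g))\<^sup>2) \<le> B\<^sup>2"
proof -
  define c where "c n = fcoeff n g" for n
  define P where "P x = (\<Sum>n\<in>\<Omega>. c n * fexp n x)" for x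
  \<comment> \<open>The sum of the squared moduli, left in product form because all three means
    involving \<open>P\<close> below reduce to it.\<close>
  define s where "s = (\<Sum>n\<in>\<Omega>. c n * cnj (c n))"
  have P: "continuous_on UNIV P" unfolding P_def by (intro continuous_intros)
  have cP: "cnj (P x) = (\<Sum>n\<in>\<Omega>. cnj (c n) * fexp (- n) x)" for x
    by (simp add: P_def cnj_fexp)
  have gP: "tmean (\<lambda>x. g x * cnj (P x)) = s"
  proof -
    have "tmean (\<lambda>x. g x * cnj (P x)) = tmean (\<lambda>x. \<Sum>n\<in>\<Omega>. cnj (c n) * (g x * fexp (- n) x))"
      by (simp add: cP sum_distrib_left mult_ac)
    also have "\<dots> = (\<Sum>n\<in>\<Omega>. tmean (\<lambda>x. cnj (c n) * (g x * fexp (- n) x)))"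
      by (intro tmean_sum continuous_intros g)
    also have "\<dots> = s"
      by (simp add: tmean_cmult s_def fcoeff_eq_tmean [symmetric] c_def mult.commute)
    finally show ?thesis .
  qed
  have fP: "fcoeff n P = c n" if "n \<in> \<Omega>" for n
    unfolding P_def by (rule fcoeff_fexp_sum [OF \<open>finite \<Omega>\<close> that])
  have PP: "tmean (\<lambda>x. P x * cnj (P x)) = s"
  proof -
    have "tmean (\<lambda>x. P x * cnj (P x)) = tmean (\<lambda>x. \<Sum>n\<in>\<Omega>. cnj (c n) * (P x * fexp (- n) x))"
      by (simp add: cP sum_distrib_left mult_ac)
    also have "\<dots> = (\<Sum>n\<in>\<Omega>. tmean (\<lambda>x. cnj (c n) * (P x * fexp (- n) x)))"
      by (intro tmean_sum continuous_intros P)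
    also have "\<dots> = s"
      by (simp add: tmean_cmult s_def fcoeff_eq_tmean [symmetric] fP mult.commute)
    finally show ?thesis .
  qed
  define d where "d x = g x - P x" for x
  have d: "continuous_on UNIV d" unfolding d_def by (intro continuous_intros g P)
  have cnjI: "continuous_on UNIV (\<lambda>x. cnj (u x))" if "continuous_on UNIV u" for u :: "real \<times> real \<Rightarrow> complex"
    using that by (intro continuous_intros)
  \<comment> \<open>The second cross term is the conjugate of the first; it equals \<open>s\<close>
    again since \<open>s\<close> is real.\<close>
  have "tmean (\<lambda>x. cnj (g x * cnj (P x))) = cnj s"
    using integral_cnj [of "cbox (0,0) (2*pi, 2*pi)" "\<lambda>x. g x * cnj (P x)"] gP
    by (auto simp: tmean_def)
  then have Pg: "tmean (\<lambda>x. P x * cnj (g x)) = s"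
    by (simp add: s_def mult.commute)
  have dd: "tmean (\<lambda>x. d x * cnj (d x)) = tmean (\<lambda>x. g x * cnj (g x)) - s"
  proof -
    have "tmean (\<lambda>x. d x * cnj (d x)) = tmean (\<lambda>x. (g x * cnj (g x) - g x * cnj (P x)) - (P x * cnj (g x) - P x * cnj (P x)))"
      by (simp add: d_def algebra_simps)
    also have "\<dots> = (tmean (\<lambda>x. g x * cnj (g x)) - s) - (s - s)"
      by (subst tmean_diff tmean_diff [of "\<lambda>x. g x * cnj (g x)"] tmean_diff [of "\<lambda>x. P x * cnj (g x)"];
          (intro continuous_intros g P cnjI)?)+ (simp add: gP Pg PP)
    finally show ?thesis by simp
  qed
  \<comment> \<open>Taking the real part inside the integral turns the integrand into the squared
    modulus of \<open>d\<close>.\<close>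
  have "0 \<le> Re (tmean (\<lambda>x. d x * cnj (d x)))"
  proof -
    have "(\<lambda>x. d x * cnj (d x)) integrable_on cbox (0,0) (2*pi, 2*pi)"
      by (intro integrable_on_torus continuous_intros d)
    from integral_linear [OF this bounded_linear_Re]
    have "Re (integral (cbox (0,0) (2*pi, 2*pi)) (\<lambda>x. d x * cnj (d x)))
        = integral (cbox (0,0) (2*pi, 2*pi)) (\<lambda>x. Re (d x * cnj (d x)))"
      by (simp add: o_def del: times_complex.sel)
    also have "\<dots> \<ge> 0"
    proof (rule integral_nonneg)
      have "continuous_on UNIV (\<lambda>x. Re (d x * cnj (d x)))" by (intro continuous_intros d)
      then show "(\<lambda>x. Re (d x * cnj (d x))) integrable_on cbox (0,0) (2*pi, 2*pi)"
        using continuous_on_subset integrable_continuous by blast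
    qed (auto simp: complex_mult_cnj)
    finally show ?thesis by (simp add: tmean_def)
  qed
  then have "Re s \<le> Re (tmean (\<lambda>x. g x * cnj (g x)))" by (simp add: dd)
  also have "\<dots> \<le> norm (tmean (\<lambda>x. g x * cnj (g x)))" by (rule complex_Re_le_cmod)
  also have "\<dots> \<le> B\<^sup>2"
    by (rule norm_tmean_le) (auto intro!: continuous_intros g simp: norm_mult power2_eq_square mult_mono' B)
  finally show ?thesis
    by (simp add: s_def c_def complex_norm_square [symmetric] del: of_real_power flip: of_real_power)
qed

section \<open>Uniform limits of trigonometric polynomials\<close>

text \<open>Generated by monomials and sums: whatever is linear in the polynomial follows by
  induction, without a normal form with distinct frequencies.\<close>

inductive trig_poly :: "(real \<times> real \<Rightarrow> complex) \<Rightarrow> bool" where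
  monomial: "trig_poly (\<lambda>x. c * fexp n x)"
| add: "trig_poly S \<Longrightarrow> trig_poly T \<Longrightarrow> trig_poly (\<lambda>x. S x + T x)"

lemma trig_poly_const: "trig_poly (\<lambda>x. c)"
  using trig_poly.monomial [of c 0] by simp

lemma trig_poly_continuous: "trig_poly T \<Longrightarrow> continuous_on UNIV T"
  by (induction rule: trig_poly.induct) (auto intro!: continuous_intros)

lemma trig_poly_mult_fexp: "trig_poly T \<Longrightarrow> trig_poly (\<lambda>x. c * T x * fexp m x)"
proof (induction rule: trig_poly.induct)
  case (monomial d n)
  then show ?case using trig_poly.monomial [of "c * d" "n + m"] by (simp add: fexp_mult [symmetric] mult_ac)
next
  case (add S T)
  then show ?case using trig_poly.add by (simp add: algebra_simps)
qed

lemma trig_poly_mult: "trig_poly S \<Longrightarrow> trig_poly T \<Longrightarrow> trig_poly (\<lambda>x. S x * T x)"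
proof (induction rule: trig_poly.induct)
  case (monomial c n)
  then show ?case using trig_poly_mult_fexp [of T c n] by (simp add: mult_ac)
next
  case (add S T')
  then show ?case using trig_poly.add by (simp add: distrib_right)
qed

lemma trig_poly_sum:
  "finite I \<Longrightarrow> (\<And>i. i \<in> I \<Longrightarrow> trig_poly (T i)) \<Longrightarrow> trig_poly (\<lambda>x. \<Sum>i\<in>I. T i x)"
  by (induction rule: finite_induct) (auto intro: trig_poly_const trig_poly.add)

text \<open>By Weierstrass these are the continuous functions on the torus. The closure form lets
  identities be checked on exponentials and passed to the limit.\<close>

definition trig_approx :: "(real \<times> real \<Rightarrow> complex) \<Rightarrow> bool" where
  "trig_approx g \<longleftrightarrow> (\<forall>\<epsilon>>0. \<exists>T. trig_poly T \<and> (\<forall>x. norm (g x - T x) \<le> \<epsilon>))"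

lemma trig_approxE:
  assumes "trig_approx g" "\<epsilon> > 0"
  obtains T where "trig_poly T" "\<And>x. norm (g x - T x) \<le> \<epsilon>"
  using assms by (auto simp: trig_approx_def)

lemma trig_approx_continuous:
  assumes "trig_approx g"
  shows "continuous_on UNIV g"
proof -
  have "\<exists>T. trig_poly T \<and> (\<forall>x. norm (g x - T x) \<le> inverse (Suc n))" for n
    using trig_approxE [OF assms, of "inverse (Suc n)"] by (metis inverse_positive_iff_positive of_nat_0_less_iff zero_less_Suc)
  then obtain T where T: "\<And>n. trig_poly (T n)" "\<And>n x. norm (g x - T n x) \<le> inverse (Suc n)"
    by metis
  have "uniform_limit UNIV T g sequentially"
  proof (rule uniform_limitI)
    fix e :: real assume "e > 0"
    then have "\<forall>\<^sub>F n in sequentially. inverse (Suc n) < e"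
      using order_tendstoD(2) [OF LIMSEQ_inverse_real_of_nat] by blast
    then show "\<forall>\<^sub>F n in sequentially. \<forall>x\<in>UNIV. dist (T n x) (g x) < e"
      by eventually_elim (metis T(2) dist_commute dist_norm le_less_trans)
  qed
  then show ?thesis
    using uniform_limit_theorem [OF always_eventually _ sequentially_bot, of UNIV T] T(1) trig_poly_continuous by simp
qed

lemma trig_approx_diff:
  assumes "trig_approx g" "trig_approx h"
  shows "trig_approx (\<lambda>x. g x - h x)"
  unfolding trig_approx_def
proof (intro allI impI)
  fix e :: real assume "e > 0"
  obtain S where S: "trig_poly S" "\<And>x. norm (g x - S x) \<le> e/2"
    using trig_approxE [OF assms(1), of "e/2"] \<open>e > 0\<close> by auto
  obtain T where T: "trig_poly T" "\<And>x. norm (h x - T x) \<le> e/2"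
    using trig_approxE [OF assms(2), of "e/2"] \<open>e > 0\<close> by auto
  have "norm (g x - h x - (S x + (-1) * T x)) \<le> e" for x
  proof -
    have "norm (g x - h x - (S x + (-1) * T x)) = norm ((g x - S x) - (h x - T x))"
      by (simp add: algebra_simps)
    also have "\<dots> \<le> e/2 + e/2" by (intro norm_triangle_le_diff add_mono S T)
    finally show ?thesis by simp
  qed
  then show "\<exists>U. trig_poly U \<and> (\<forall>x. norm (g x - h x - U x) \<le> e)"
    using trig_poly.add [OF S(1) trig_poly_mult [OF trig_poly_const [of "-1"] T(1)]] by blast
qed

lemma trig_approx_mult_fexp:
  assumes "trig_approx g"
  shows "trig_approx (\<lambda>x. g x * fexp n x)"
  unfolding trig_approx_def
proof (intro allI impI)
  fix e :: real assume "e > 0"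
  obtain S where S: "trig_poly S" "\<And>x. norm (g x - S x) \<le> e"
    using trig_approxE [OF assms(1), of "e"] \<open>e > 0\<close> by auto
  have "norm (g x * fexp n x - 1 * S x * fexp n x) \<le> e" for x
  proof -
    have "norm (g x * fexp n x - 1 * S x * fexp n x) = norm ((g x - S x) * fexp n x)"
      by (simp add: algebra_simps)
    then show ?thesis using S(2) [of x] by (simp add: norm_mult)
  qed
  then show "\<exists>U. trig_poly U \<and> (\<forall>x. norm (g x * fexp n x - U x) \<le> e)"
    using trig_poly_mult_fexp [OF S(1), of 1 n] by blast
qed

text \<open>Both sides are linear in \<open>g\<close> and continuous in the sup norm, so equality on
  exponentials extends to uniform limits. This replaces a change of variables in the
  integral.\<close>

lemma tmean_invariant:
  assumes g: "trig_approx g" and A: "continuous_on UNIV A"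
    and inv: "\<And>n. tmean (\<lambda>x. fexp n (A x)) = tmean (fexp n)"
  shows "tmean (\<lambda>x. g (A x)) = tmean g"
proof -
  have comp: "continuous_on UNIV (\<lambda>x. h (A x))" if "continuous_on UNIV h" for h :: "real \<times> real \<Rightarrow> complex"
    using continuous_on_compose2 [OF that A] by simp
  have T: "tmean (\<lambda>x. T (A x)) = tmean T" if "trig_poly T" for T
    using that
  proof induction
    case (monomial c n)
    then show ?case by (simp add: tmean_cmult inv)
  next
    case (add S T)
    then show ?case by (simp add: tmean_add comp trig_poly_continuous)
  qed
  have "norm (tmean (\<lambda>x. g (A x)) - tmean g) \<le> e" if "e > 0" for e
  proof -
    obtain S where S: "trig_poly S" "\<And>x. norm (g x - S x) \<le> e/2"
      using trig_approxE [OF g, of "e/2"] \<open>e > 0\<close> by auto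
    have gS: "continuous_on UNIV (\<lambda>x. g x - S x)"
      by (intro continuous_intros trig_approx_continuous trig_poly_continuous g S)
    have "norm (tmean (\<lambda>x. g x - S x)) \<le> e/2"
      using gS S by (intro norm_tmean_le) auto
    moreover have "norm (tmean (\<lambda>x. g (A x) - S (A x))) \<le> e/2"
      using comp [OF gS] S by (intro norm_tmean_le) auto
    moreover have "tmean (\<lambda>x. g (A x)) - tmean g = tmean (\<lambda>x. g (A x) - S (A x)) - tmean (\<lambda>x. g x - S x)"
      using T [OF S(1)] by (simp add: tmean_diff comp trig_approx_continuous trig_poly_continuous g S)
    ultimately show ?thesis using norm_triangle_le_diff by (smt (verit) field_sum_of_halves)
  qed
  then have "norm (tmean (\<lambda>x. g (A x)) - tmean g) \<le> 0" by (rule field_le_epsilon) auto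
  then show ?thesis by simp
qed

text \<open>Translating an exponential multiplies it by a constant, so its mean stays 0 unless the
  frequency is 0. Invariance of the mean is then applied to \<open>g\<close> times
  \<open>fexp (- n)\<close>, and pulling the constant \<open>fexp (- n) v\<close> out gives the
  factor.\<close>

lemma fcoeff_shift:
  assumes g: "trig_approx g"
  shows "fcoeff n (\<lambda>x. g (x + v)) = fexp n v * fcoeff n g"
proof -
  have "tmean (\<lambda>x. g (x + v) * fexp (- n) (x + v)) = tmean (\<lambda>x. g x * fexp (- n) x)"
  proof (rule tmean_invariant [OF trig_approx_mult_fexp [OF g]])
    show "continuous_on UNIV (\<lambda>x. x + v)" by (intro continuous_intros)
    show "tmean (\<lambda>x. fexp m (x + v)) = tmean (fexp m)" for m
      using tmean_cmult [of "fexp m v" "fexp m"] by (simp add: fexp_add_arg tmean_fexp mult.commute)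
  qed
  moreover have "(\<lambda>x. g (x + v) * fexp (- n) (x + v)) = (\<lambda>x. fexp (- n) v * (g (x + v) * fexp (- n) x))"
    by (simp add: fexp_add_arg mult_ac)
  ultimately have "fexp (- n) v * fcoeff n (\<lambda>x. g (x + v)) = fcoeff n g"
    by (simp add: tmean_cmult fcoeff_eq_tmean)
  then have "fcoeff n g * fexp n v = (fexp n v * fexp (- n) v) * fcoeff n (\<lambda>x. g (x + v))"
    by (simp add: mult_ac)
  then show ?thesis by (simp add: fexp_mult mult_ac)
qed

text \<open>The half turn in longitude produces the sign and the reflected colatitude produces
  \<open>Mref\<close>; this explains the sign in \<open>en\<close>.\<close>

lemma fexp_glide: "fexp n (fst x + pi, - snd x) = (-1) ^ nat \<bar>fst n\<bar> * fexp (Mref n) x"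
proof -
  have "exp (\<i> * complex_of_real (of_int k * pi)) = (-1) ^ nat \<bar>k\<bar>" for k :: int
  proof -
    have "exp (\<i> * complex_of_real (of_int k * pi)) = cis (of_int k * pi)"
      by (simp add: cis_conv_exp)
    also have "\<dots> = (if even k then 1 else -1)"
      using cos_npi_int [of k] sin_npi_int [of k] by (auto simp: complex_eq_iff mult.commute)
    finally show ?thesis by (simp add: even_nat_iff)
  qed
  moreover have "fexp n (fst x + pi, - snd x) = exp (\<i> * complex_of_real (of_int (fst n) * pi)) * fexp (Mref n) x"
    by (simp add: fexp_def ip_def Mref_def exp_add [symmetric] algebra_simps)
  ultimately show ?thesis by simp
qed

text \<open>The symmetry \<open>g (\<lambda> + \<pi>, - \<theta>) = g (\<lambda>, \<theta>)\<close> is shared by all DFS functions.\<close>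
lemma fcoeff_Mref:
  assumes g: "trig_approx g" and sym: "\<And>x. g (fst x + pi, - snd x) = g x"
  shows "fcoeff (Mref n) g = (-1) ^ nat \<bar>fst n\<bar> * fcoeff n g"
proof -
  have "tmean (\<lambda>x. g (fst x + pi, - snd x) * fexp (- n) (fst x + pi, - snd x)) = tmean (\<lambda>x. g x * fexp (- n) x)"
  proof (rule tmean_invariant [OF trig_approx_mult_fexp [OF g]])
    show "continuous_on UNIV (\<lambda>x::real\<times>real. (fst x + pi, - snd x))" by (intro continuous_intros)
    show "tmean (\<lambda>x. fexp m (fst x + pi, - snd x)) = tmean (fexp m)" for m
      by (auto simp: fexp_glide tmean_cmult tmean_fexp Mref_def prod_eq_iff)
  qed
  moreover have "Mref (- n) = - Mref n" by (simp add: Mref_def)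
  ultimately have "(-1) ^ nat \<bar>fst n\<bar> * fcoeff (Mref n) g = fcoeff n g"
    by (simp add: sym fexp_glide fcoeff_eq_tmean mult.left_commute [of "g _"] tmean_cmult)
  then have "(-1) ^ nat \<bar>fst n\<bar> * fcoeff n g = ((-1) ^ nat \<bar>fst n\<bar> * (-1) ^ nat \<bar>fst n\<bar>) * fcoeff (Mref n) g"
    by (metis mult.assoc)
  also have "((-1) ^ nat \<bar>fst n\<bar> * (-1) ^ nat \<bar>fst n\<bar> :: complex) = 1"
    by (simp flip: power_add mult_2)
  finally show ?thesis by simp
qed

lemma fexp_periodic: "fexp n (x + (2*pi * of_int k, 2*pi * of_int l)) = fexp n x"
proof -
  have "\<i> * complex_of_real (ip n (2*pi * of_int k, 2*pi * of_int l))
      = complex_of_real (2 * of_int (fst n * k + snd n * l) * pi) * \<i>"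
    by (simp add: ip_def algebra_simps)
  then have "fexp n (2*pi * of_int k, 2*pi * of_int l) = 1"
    using exp_integer_2pi [OF Ints_of_int [of "fst n * k + snd n * l"]] by (simp only: fexp_def)
  then show ?thesis by (simp add: fexp_add_arg)
qed

lemma trig_approx_periodic:
  assumes "trig_approx g"
  shows "g (x + (2*pi * of_int k, 2*pi * of_int l)) = g x"
proof -
  have T: "T (x + (2*pi * of_int k, 2*pi * of_int l)) = T x" if "trig_poly T" for T
    using that by induction (simp_all add: fexp_periodic)
  have "norm (g (x + (2*pi * of_int k, 2*pi * of_int l)) - g x) \<le> e" if "e > 0" for e
  proof -
    obtain S where S: "trig_poly S" "\<And>x. norm (g x - S x) \<le> e/2"
      using trig_approxE [OF assms, of "e/2"] \<open>e > 0\<close> by auto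
    show ?thesis using S(2) [of x] S(2) [of "x + (2*pi * of_int k, 2*pi * of_int l)"] T [OF S(1)]
      norm_triangle_le_diff [of "g (x + (2*pi * of_int k, 2*pi * of_int l)) - S x" "g x - S x" e]
      by simp
  qed
  then have "norm (g (x + (2*pi * of_int k, 2*pi * of_int l)) - g x) \<le> 0"
    by (rule field_le_epsilon) auto
  then show ?thesis by simp
qed

text \<open>Such an \<open>h\<close> is orthogonal to every trigonometric polynomial, hence to its
  own approximants, so the mean of its squared modulus is 0. Continuity and periodicity then force
  \<open>h\<close> to vanish everywhere.\<close>

lemma trig_approx_unique:
  assumes h: "trig_approx h" and 0: "\<And>n. fcoeff n h = 0"
  shows "h x = 0"
proof -
  have ch: "continuous_on UNIV h" by (rule trig_approx_continuous [OF h])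
  have T: "tmean (\<lambda>x. h x * cnj (T x)) = 0" if "trig_poly T" for T
    using that
  proof induction
    case (monomial c n)
    have "(\<lambda>x. h x * cnj (c * fexp n x)) = (\<lambda>x. cnj c * (h x * fexp (- n) x))"
      by (simp add: cnj_fexp mult_ac)
    then show ?case by (simp add: tmean_cmult fcoeff_eq_tmean [symmetric] 0)
  next
    case (add S T)
    have "tmean (\<lambda>x. h x * cnj (S x) + h x * cnj (T x)) = 0"
      using add.IH by (subst tmean_add)
        (simp_all add: continuous_on_mult continuous_on_cnj ch trig_poly_continuous add.hyps)
    then show ?case by (simp add: distrib_left)
  qed
  have "bounded (h ` cbox (0,0) (2*pi, 2*pi))"
    using ch by (intro compact_imp_bounded compact_continuous_image continuous_on_subset [OF ch]) auto
  then obtain B where B: "B > 0" "\<And>x. x \<in> cbox (0,0) (2*pi, 2*pi) \<Longrightarrow> norm (h x) \<le> B"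
    by (auto simp: bounded_pos)
  \<comment> \<open>Reduction modulo 2 pi into the period square; it extends first the bound
    \<open>B\<close> and later the vanishing of \<open>h\<close> from the square to the whole
    plane.\<close>
  define red where "red y = (y - 2*pi * of_int \<lfloor>y / (2*pi)\<rfloor>)" for y :: real
  have red: "red y \<in> {0..2*pi}" for y
    using floor_divide_lower [of "2*pi" y] floor_divide_upper [of "2*pi" y] by (auto simp: red_def algebra_simps)
  have hred: "h x = h (red (fst x), red (snd x))" for x
    using trig_approx_periodic [OF h, of x "- \<lfloor>fst x / (2*pi)\<rfloor>" "- \<lfloor>snd x / (2*pi)\<rfloor>"]
    by (cases x) (simp add: red_def)
  have box: "(red (fst x), red (snd x)) \<in> cbox (0,0) (2*pi, 2*pi)" for x
    using red by (auto simp: cbox_Pair_eq)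
  have hB: "norm (h x) \<le> B" for x
    using B(2) [OF box [of x]] hred [of x] by simp
  have "norm (tmean (\<lambda>x. h x * cnj (h x))) \<le> e" if "e > 0" for e
  proof -
    \<comment> \<open>The error of \<open>S\<close> will be multiplied by \<open>h\<close>, hence
      the division by \<open>B\<close>.\<close>
    obtain S where S: "trig_poly S" "\<And>x. norm (h x - S x) \<le> e/B"
      using trig_approxE [OF h, of "e/B"] \<open>e > 0\<close> B by auto
    have cS: "continuous_on UNIV S" by (rule trig_poly_continuous [OF S(1)])
    have "tmean (\<lambda>x. h x * cnj (h x)) = tmean (\<lambda>x. h x * cnj (h x)) - tmean (\<lambda>x. h x * cnj (S x))"
      using T [OF S(1)] by simp
    also have "\<dots> = tmean (\<lambda>x. h x * cnj (h x) - h x * cnj (S x))"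
      by (intro tmean_diff [symmetric] continuous_intros ch cS)
    also have "norm \<dots> \<le> e"
    proof (rule norm_tmean_le)
      show "continuous_on UNIV (\<lambda>x. h x * cnj (h x) - h x * cnj (S x))"
        by (intro continuous_intros ch cS)
      show "norm (h x * cnj (h x) - h x * cnj (S x)) \<le> e" for x
      proof -
        have "norm (h x * cnj (h x) - h x * cnj (S x)) = norm (h x) * norm (h x - S x)"
          by (metis complex_cnj_diff complex_mod_cnj norm_mult right_diff_distrib)
        also have "\<dots> \<le> B * (e / B)" by (intro mult_mono' S hB) auto
        finally show ?thesis using B by simp
      qed
    qed
    finally show ?thesis .
  qed
  then have "norm (tmean (\<lambda>x. h x * cnj (h x))) \<le> 0"
    by (rule field_le_epsilon) auto
  then have int0: "integral (cbox (0,0) (2*pi, 2*pi)) (\<lambda>x. h x * cnj (h x)) = 0"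
    by (simp add: tmean_def)
  have "(\<lambda>x. h x * cnj (h x)) integrable_on cbox (0,0) (2*pi, 2*pi)"
    by (intro integrable_on_torus continuous_intros ch)
  from integral_linear [OF this bounded_linear_Re] int0
  have "integral (cbox (0,0) (2*pi, 2*pi)) (\<lambda>x. Re (h x * cnj (h x))) = 0"
    by (simp add: o_def del: times_complex.sel)
  \<comment> \<open>A continuous nonnegative function with integral 0 over a box with nonempty
    interior vanishes on that box.\<close>
  then have "\<forall>x\<in>cbox (0,0) (2*pi, 2*pi). Re (h x * cnj (h x)) = 0"
  proof (subst (asm) integral_cbox_eq_0_iff)
    show "continuous_on (cbox (0,0) (2*pi, 2*pi)) (\<lambda>x. Re (h x * cnj (h x)))"
      by (intro continuous_intros continuous_on_subset [OF ch]) auto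
    show "box (0,0) (2*pi, 2*pi) \<noteq> {}"
      by (auto simp: box_ne_empty Basis_prod_def)
  qed (auto simp: complex_mult_cnj)
  then have "Re (h (red (fst x), red (snd x)) * cnj (h (red (fst x), red (snd x)))) = 0"
    using box by blast
  then show ?thesis
    using hred [of x] by (simp add: complex_mult_cnj complex_eq_iff sum_power2_eq_zero_iff del: times_complex.sel)
qed

section \<open>Convergence and absolute summability\<close>

text \<open>The tail is the total minus a finite sum, so this is convergence of the net of finite
  sums. Covering all larger sets allows further indices to be added later.\<close>

lemma infsum_tail_small:
  fixes f :: "'a \<Rightarrow> real"
  assumes f: "f summable_on UNIV" and "e > 0"
  obtains F where "finite F" "\<And>\<Omega>. finite \<Omega> \<Longrightarrow> F \<subseteq> \<Omega> \<Longrightarrow> infsum f (UNIV - \<Omega>) < e"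
proof -
  have tail: "infsum f (UNIV - \<Omega>) = infsum f UNIV - sum f \<Omega>" if "finite \<Omega>" for \<Omega>
    using that f infsum_Diff [of f UNIV \<Omega>] by (simp add: summable_on_finite)
  have "\<forall>\<^sub>F F in finite_subsets_at_top UNIV. dist (sum f F) (infsum f UNIV) < e"
    using infsum_tendsto [OF f] \<open>e > 0\<close> by (rule tendstoD)
  then obtain F where F: "finite F" "\<And>\<Omega>. finite \<Omega> \<Longrightarrow> F \<subseteq> \<Omega> \<Longrightarrow> dist (sum f \<Omega>) (infsum f UNIV) < e"
    by (auto simp: eventually_finite_subsets_at_top)
  show thesis
  proof (rule that [OF F(1)])
    fix \<Omega> assume "finite \<Omega>" "F \<subseteq> \<Omega>"
    then show "infsum f (UNIV - \<Omega>) < e"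
      using F(2) [of \<Omega>] tail [of \<Omega>] by (simp add: dist_real_def)
  qed
qed

text \<open>An increasing exhausting sequence contains any given finite set from some index
  on.\<close>

lemma infsum_tail_eventually_small:
  fixes f :: "'a \<Rightarrow> real"
  assumes "f summable_on UNIV" and "e > 0"
    and fin: "\<And>h. finite (\<Omega> h)" and inc: "\<And>h. \<Omega> h \<subseteq> \<Omega> (Suc h)" and ex: "(\<Union>h. \<Omega> h) = UNIV"
  shows "\<forall>\<^sub>F h in sequentially. infsum f (UNIV - \<Omega> h) < e"
proof -
  obtain F where F: "finite F" "\<And>\<Omega>. finite \<Omega> \<Longrightarrow> F \<subseteq> \<Omega> \<Longrightarrow> infsum f (UNIV - \<Omega>) < e"
    using infsum_tail_small assms(1,2) by blast
  have "\<forall>n. \<exists>h. n \<in> \<Omega> h" using ex by blast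
  then obtain l where l: "\<And>n. n \<in> \<Omega> (l n)" by metis
  obtain N where N: "\<And>n. n \<in> F \<Longrightarrow> l n \<le> N"
    using finite_nat_set_iff_bounded_le [of "l ` F"] \<open>finite F\<close> by auto
  have "F \<subseteq> \<Omega> h" if "h \<ge> N" for h
    using l N that lift_Suc_mono_le [of \<Omega>, OF inc] by (meson order_trans subset_iff)
  then have "infsum f (UNIV - \<Omega> h) < e" if "h \<ge> N" for h
    using F(2) fin that by blast
  then show ?thesis using eventually_sequentially by blast
qed

text \<open>Absolute summability makes the sum \<open>F\<close> of the series a uniform limit of its
  partial sums, with the same Fourier coefficients as \<open>g\<close>. Uniqueness gives
  \<open>F = g\<close>, and the error is a tail of the series.\<close>

lemma norm_diff_Fpart_le:
  assumes g: "trig_approx g" and s: "(\<lambda>n. norm (fcoeff n g)) summable_on UNIV" and "finite \<Omega>"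
  shows "norm (g x - Fpart \<Omega> g x) \<le> (\<Sum>\<^sub>\<infinity>n\<in>UNIV - \<Omega>. norm (fcoeff n g))"
proof -
  define F where "F x = (\<Sum>\<^sub>\<infinity>n. fcoeff n g * fexp n x)" for x
  have abs: "(\<lambda>n. norm (fcoeff n g * fexp n x)) summable_on A" for x A
    using summable_on_subset_banach [OF s] by (simp add: norm_mult)
  have tail: "norm (F x - Fpart \<Omega> g x) \<le> (\<Sum>\<^sub>\<infinity>n\<in>UNIV - \<Omega>. norm (fcoeff n g))" if "finite \<Omega>" for x \<Omega>
  proof -
    have "F x - Fpart \<Omega> g x = (\<Sum>\<^sub>\<infinity>n\<in>UNIV - \<Omega>. fcoeff n g * fexp n x)"
      unfolding F_def Fpart_eq
      using infsum_Diff [of "\<lambda>n. fcoeff n g * fexp n x" UNIV \<Omega>] abs [of x] that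
      by (simp add: abs_summable_summable)
    then show ?thesis using norm_infsum_bound [OF abs [of x "UNIV - \<Omega>"]] by (simp add: norm_mult)
  qed
  have poly: "trig_poly (Fpart \<Omega> g)" if "finite \<Omega>" for \<Omega>
    unfolding Fpart_eq by (rule trig_poly_sum [OF that trig_poly.monomial])
  have F: "trig_approx F"
    unfolding trig_approx_def
  proof (intro allI impI)
    fix e :: real assume "e > 0"
    then obtain \<Omega> where "finite \<Omega>" "(\<Sum>\<^sub>\<infinity>n\<in>UNIV - \<Omega>. norm (fcoeff n g)) < e"
      using infsum_tail_small [OF s] by (metis order_refl)
    then show "\<exists>T. trig_poly T \<and> (\<forall>x. norm (F x - T x) \<le> e)"
      using poly tail by (meson less_imp_le order_trans)
  qed
  have coeff: "fcoeff n F = fcoeff n g" for n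
  proof -
    have "norm (fcoeff n F - fcoeff n g) \<le> e" if "e > 0" for e
    proof -
      obtain \<Omega> where \<Omega>: "finite \<Omega>" "\<And>\<Omega>'. finite \<Omega>' \<Longrightarrow> \<Omega> \<subseteq> \<Omega>' \<Longrightarrow> (\<Sum>\<^sub>\<infinity>n\<in>UNIV - \<Omega>'. norm (fcoeff n g)) < e"
        using infsum_tail_small [OF s \<open>e > 0\<close>] by metis
      \<comment> \<open>With \<open>n\<close> included, the partial sum has exactly the
        \<open>n\<close>-th coefficient of \<open>g\<close>.\<close>
      define \<Omega>' where "\<Omega>' = insert n \<Omega>"
      have "finite \<Omega>'" "n \<in> \<Omega>'" "\<Omega> \<subseteq> \<Omega>'" using \<Omega> by (auto simp: \<Omega>'_def)
      have "norm (fcoeff n (\<lambda>x. F x - Fpart \<Omega>' g x)) \<le> e"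
      proof (rule norm_fcoeff_le)
        show "continuous_on UNIV (\<lambda>x. F x - Fpart \<Omega>' g x)"
          by (intro continuous_intros trig_approx_continuous trig_poly_continuous F poly) fact
        show "norm (F x - Fpart \<Omega>' g x) \<le> e" for x
          using tail [OF \<open>finite \<Omega>'\<close>, of x] \<Omega>(2) [OF \<open>finite \<Omega>'\<close> \<open>\<Omega> \<subseteq> \<Omega>'\<close>] by linarith
      qed
      moreover have "fcoeff n (Fpart \<Omega>' g) = fcoeff n g"
        unfolding Fpart_eq by (rule fcoeff_fexp_sum) fact+
      ultimately show ?thesis
        using fcoeff_diff [OF trig_approx_continuous [OF F] trig_poly_continuous [OF poly [OF \<open>finite \<Omega>'\<close>]]]
        by simp
    qed
    then have "norm (fcoeff n F - fcoeff n g) \<le> 0" by (rule field_le_epsilon) auto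
    then show ?thesis by simp
  qed
  have "g x - F x = 0"
    by (rule trig_approx_unique [OF trig_approx_diff [OF g F]])
       (simp add: fcoeff_diff trig_approx_continuous g F coeff)
  then show ?thesis using tail [OF \<open>finite \<Omega>\<close>, of x] by simp
qed

section \<open>Second differences and Bernstein's theorem\<close>

lemma fcoeff_second_difference:
  assumes g: "trig_approx g"
  shows "fcoeff n (\<lambda>x. g (x + v) - 2 * g x + g (x - v)) = complex_of_real (2 * cos (ip n v) - 2) * fcoeff n g"
proof -
  have cg: "continuous_on UNIV (\<lambda>x. g (x + w))" for w
    by (rule continuous_on_compose2 [OF trig_approx_continuous [OF g]]) (auto intro!: continuous_intros)
  have "fcoeff n (\<lambda>x. g (x + v) - 2 * g x + g (x + - v))
      = fcoeff n (\<lambda>x. g (x + v)) - 2 * fcoeff n g + fcoeff n (\<lambda>x. g (x + - v))"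
    using cg [of 0] cg [of v] cg [of "- v"]
    by (subst fcoeff_add; (subst fcoeff_diff)?) (auto intro!: continuous_intros simp: fcoeff_cmult)
  then have "fcoeff n (\<lambda>x. g (x + v) - 2 * g x + g (x + - v)) = (fexp n v - 2 + fexp n (- v)) * fcoeff n g"
    unfolding fcoeff_shift [OF g] by (simp add: algebra_simps)
  moreover have "fexp n (- v) = cnj (fexp n v)"
    unfolding cnj_fexp by (simp add: fexp_def ip_def)
  \<comment> \<open>The two opposite translations contribute conjugate factors, whose sum is
    real.\<close>
  moreover have "fexp n v + cnj (fexp n v) = complex_of_real (2 * cos (ip n v))"
    unfolding complex_add_cnj by (simp add: fexp_def Re_exp)
  ultimately show ?thesis by (simp add: algebra_simps)
qed

lemma Bessel_second_difference:
  assumes g: "trig_approx g" and B: "\<And>x. norm (g (x + v) - 2 * g x + g (x - v)) \<le> B" and "finite \<Omega>"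
  shows "(\<Sum>n\<in>\<Omega>. (2 - 2 * cos (ip n v))\<^sup>2 * (norm (fcoeff n g))\<^sup>2) \<le> B\<^sup>2"
proof -
  have cg: "continuous_on UNIV (\<lambda>x. g (x + w))" for w
    by (rule continuous_on_compose2 [OF trig_approx_continuous [OF g]]) (auto intro!: continuous_intros)
  have "continuous_on UNIV (\<lambda>x. g (x + v) - 2 * g x + g (x - v))"
    using cg [of v] cg [of 0] cg [of "- v"] by (auto intro!: continuous_intros)
  then have "(\<Sum>n\<in>\<Omega>. (norm (fcoeff n (\<lambda>x. g (x + v) - 2 * g x + g (x - v))))\<^sup>2) \<le> B\<^sup>2"
    using B \<open>finite \<Omega>\<close> by (rule Bessel)
  moreover have "(norm (complex_of_real (2 * cos (ip n v) - 2) * fcoeff n g))\<^sup>2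
      = (2 - 2 * cos (ip n v))\<^sup>2 * (norm (fcoeff n g))\<^sup>2" for n
    by (simp only: norm_mult norm_of_real power_mult_distrib power2_abs power2_commute)
  ultimately show ?thesis by (simp only: fcoeff_second_difference [OF g])
qed

text \<open>The step is chosen so that the angle lies between pi/3 and 2 pi/3 in absolute value,
  where the cosine is at most its value at pi/3. Thus \<open>2 - 2 * cos\<close> is at least
  1.\<close>

lemma cos_dyadic_le:
  fixes k :: int
  assumes "2 ^ m \<le> \<bar>k\<bar>" "\<bar>k\<bar> < 2 ^ Suc m"
  shows "cos (of_int k * (pi / (3 * 2 ^ m))) \<le> 1 / 2"
proof -
  define t where "t = pi / (3 * 2 ^ m)"
  have t: "t > 0" "t * 2 ^ m = pi / 3" by (auto simp: t_def)
  have k: "2 ^ m \<le> real_of_int \<bar>k\<bar>" "real_of_int \<bar>k\<bar> < 2 * 2 ^ m"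
    using assms by (metis of_int_le_iff of_int_numeral of_int_power)
       (metis assms(2) of_int_less_iff of_int_numeral of_int_power power_Suc)
  have "t * 2 ^ m \<le> t * real_of_int \<bar>k\<bar>" "t * real_of_int \<bar>k\<bar> \<le> t * (2 * 2 ^ m)"
    by (intro mult_left_mono; use k t in simp)+
  then have "cos (t * real_of_int \<bar>k\<bar>) \<le> cos (pi / 3)"
    using t(2) pi_gt_zero by (intro cos_monotone_0_pi_le) linarith+
  moreover have "cos (t * real_of_int \<bar>k\<bar>) = cos (real_of_int k * t)"
    by (auto simp: abs_if mult.commute)
  ultimately show ?thesis by (simp add: cos_60 t_def)
qed

text \<open>Bernstein's theorem in dimension two. On the dyadic shell
  \<open>2^m \<le> max |n\<^sub>1| |n\<^sub>2| < 2^(m+1)\<close> one of the two second differences with step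
  \<open>\<pi> / (3 \<cdot> 2^m)\<close> multiplies \<open>c\<^sub>n\<close> by a factor of modulus at least 1; since the shell has
  \<open>O(4^m)\<close> elements, Cauchy-Schwarz gives \<open>\<Sum> |c\<^sub>n| = O(2^(- m \<beta>))\<close> on it.\<close>
lemma fcoeff_summable:
  assumes g: "trig_approx g" and \<beta>: "0 < \<beta>"
    and d1: "\<And>x t. 0 < t \<Longrightarrow> t \<le> pi/3 \<Longrightarrow> norm (g (x + (t,0)) - 2 * g x + g (x - (t,0))) \<le> K * t powr (1 + \<beta>)"
    and d2: "\<And>x t. 0 < t \<Longrightarrow> t \<le> pi/3 \<Longrightarrow> norm (g (x + (0,t)) - 2 * g x + g (x - (0,t))) \<le> K * t powr (1 + \<beta>)"
  shows "(\<lambda>n. norm (fcoeff n g)) summable_on UNIV"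
proof -
  define mx :: "int \<times> int \<Rightarrow> int" where "mx n = max \<bar>fst n\<bar> \<bar>snd n\<bar>" for n
  define c where "c n = norm (fcoeff n g)" for n
  define r where "r = 2 powr (- \<beta>)"
  \<comment> \<open>The 16 rounds up the square root of \<open>2 * 8^2\<close>, the product of the
    constants in \<open>c2\<close> and \<open>card\<close>; the power of \<open>pi/3\<close> comes
    from the step \<open>t\<close>.\<close>
  define C where "C = 16 * K * (pi/3) powr (1 + \<beta>)"
  have r: "0 < r" "r < 1" using \<beta> powr_less_mono [of "-\<beta>" 0 2] by (auto simp: r_def)
  have "0 \<le> K"
  proof -
    have "0 \<le> K * (pi/3) powr (1 + \<beta>)"
      by (rule order_trans [OF norm_ge_zero d1 [of "pi/3" 0]]) auto
    then show ?thesis by (simp add: zero_le_mult_iff)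
  qed
  then have "C \<ge> 0" by (simp add: C_def)
  have shell: "sum c \<Omega> \<le> C * r ^ m"
    if "finite \<Omega>" and \<Omega>: "\<And>n. n \<in> \<Omega> \<Longrightarrow> 2 ^ m \<le> mx n \<and> mx n < 2 ^ Suc m" for \<Omega> m
  proof -
    define t where "t = pi / (3 * 2 ^ m)"
    have t: "0 < t" "t \<le> pi/3" by (auto simp: t_def field_simps)
    define w where "w n j = (2 - 2 * cos (of_int j * t))\<^sup>2 * (c n)\<^sup>2" for n and j :: int
    define b where "b = K * t powr (1 + \<beta>)"
    have "b \<ge> 0" using \<open>K \<ge> 0\<close> by (simp add: b_def)
    have "(\<Sum>n\<in>\<Omega>. w n (fst n)) \<le> b\<^sup>2"
      using Bessel_second_difference [OF g d1 [OF t] \<open>finite \<Omega>\<close>] by (simp add: ip_def w_def c_def b_def)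
    moreover have "(\<Sum>n\<in>\<Omega>. w n (snd n)) \<le> b\<^sup>2"
      using Bessel_second_difference [OF g d2 [OF t] \<open>finite \<Omega>\<close>] by (simp add: ip_def w_def c_def b_def)
    moreover have "(c n)\<^sup>2 \<le> w n (fst n) + w n (snd n)" if "n \<in> \<Omega>" for n
    proof -
      have nn: "0 \<le> w n j" for j by (simp add: w_def)
      have big: "(c n)\<^sup>2 \<le> w n j" if "2 ^ m \<le> \<bar>j\<bar>" "\<bar>j\<bar> < 2 ^ Suc m" for j
      proof -
        have "1 \<le> 2 - 2 * cos (of_int j * t)"
          using cos_dyadic_le [OF that] by (simp add: t_def)
        then have "1 \<le> (2 - 2 * cos (of_int j * t))\<^sup>2" by (rule one_le_power)
        then show ?thesis unfolding w_def using mult_right_mono by fastforce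
      qed
      have "(2 ^ m \<le> \<bar>fst n\<bar> \<and> \<bar>fst n\<bar> < 2 ^ Suc m) \<or> (2 ^ m \<le> \<bar>snd n\<bar> \<and> \<bar>snd n\<bar> < 2 ^ Suc m)"
        using \<Omega> [OF \<open>n \<in> \<Omega>\<close>] by (auto simp: mx_def max_def split: if_splits)
      then show ?thesis using big nn by (meson add_increasing add_increasing2)
    qed
    ultimately have c2: "(\<Sum>n\<in>\<Omega>. (c n)\<^sup>2) \<le> 2 * b\<^sup>2"
      using sum_mono [of \<Omega> "\<lambda>n. (c n)\<^sup>2" "\<lambda>n. w n (fst n) + w n (snd n)"] by (simp add: sum.distrib)
    \<comment> \<open>A crude count by the enclosing square, with \<open>2 * 2 ^ Suc m + 1\<close>
      points per side.\<close>
    have "\<Omega> \<subseteq> {- (2 ^ Suc m)..2 ^ Suc m} \<times> {- (2 ^ Suc m)..2 ^ Suc m}"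
      using \<Omega> by (force simp: mx_def)
    then have "card \<Omega> \<le> card ({- (2 ^ Suc m)..2 ^ Suc m :: int} \<times> {- (2 ^ Suc m)..2 ^ Suc m :: int})"
      by (intro card_mono) auto
    also have "\<dots> = (nat (2 * 2 ^ Suc m + 1))\<^sup>2"
      by (simp add: card_cartesian_product power2_eq_square)
    also have "\<dots> \<le> (8 * 2 ^ m)\<^sup>2"
    proof (rule power_mono)
      have "(1::int) \<le> 2 ^ m" by simp
      then have "2 * 2 ^ Suc m + 1 \<le> (int (8 * 2 ^ m))"
        unfolding power_Suc of_nat_mult of_nat_power of_nat_numeral by linarith
      then show "nat (2 * 2 ^ Suc m + 1) \<le> 8 * 2 ^ m" by linarith
    qed simp
    finally have "real (card \<Omega>) \<le> real ((8 * 2 ^ m)\<^sup>2)"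
      by (rule of_nat_mono)
    then have card: "real (card \<Omega>) \<le> (8 * 2 ^ m)\<^sup>2" by simp
    have "(sum c \<Omega>)\<^sup>2 \<le> (\<Sum>n\<in>\<Omega>. (c n)\<^sup>2) * real (card \<Omega>)"
      by (rule sum_squared_le_sum_of_squares)
    also have "\<dots> \<le> (2 * b\<^sup>2) * (8 * 2 ^ m)\<^sup>2"
      by (intro mult_mono c2 card) auto
    also have "\<dots> \<le> (16 * b * 2 ^ m)\<^sup>2"
      by (simp add: power_mult_distrib)
    finally have "sum c \<Omega> \<le> 16 * b * 2 ^ m"
      by (rule power2_le_imp_le) (use \<open>b \<ge> 0\<close> in simp)
    \<comment> \<open>The factor \<open>2 ^ m\<close> from the cardinality cancels one power of the
      step; only the exponent \<open>\<beta>\<close> is left, which yields the geometric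
      decay.\<close>
    also have "\<dots> = C * r ^ m"
    proof -
      have "t powr (1 + \<beta>) = (pi/3) powr (1 + \<beta>) / (2 ^ m) powr (1 + \<beta>)"
        by (simp add: t_def powr_divide powr_mult)
      also have "(2 ^ m) powr (1 + \<beta>) = (2::real) ^ m / r ^ m"
      proof -
        have "r ^ m = 2 powr (- (real m * \<beta>))"
          by (simp add: r_def powr_power mult.commute)
        moreover have "(2 ^ m) powr \<beta> = (2::real) powr (real m * \<beta>)"
          using powr_powr [of 2 "real m" \<beta>] by (simp add: powr_realpow)
        ultimately show ?thesis by (simp add: powr_add powr_minus divide_inverse)
      qed
      finally show ?thesis using r by (simp add: b_def C_def)
    qed
    finally show ?thesis .
  qed
  have "\<exists>m. 2 ^ m \<le> mx n \<and> mx n < 2 ^ Suc m" if "n \<noteq> 0" for n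
  proof -
    have "mx n \<ge> 1" using that by (cases n) (auto simp: mx_def zero_prod_def)
    then have "1 \<le> nat (mx n)" by simp
    then obtain m where m: "2 ^ m \<le> nat (mx n)" "nat (mx n) < 2 ^ (m + 1)"
      using ex_power_ivl1 [of 2 "nat (mx n)"] by auto
    then have "int (2 ^ m) \<le> mx n" "mx n < int (2 ^ (m + 1))"
      using \<open>mx n \<ge> 1\<close> by linarith+
    then show ?thesis by (intro exI [of _ m]) auto
  qed
  then obtain lev where lev: "\<And>n. n \<noteq> 0 \<Longrightarrow> 2 ^ lev n \<le> mx n \<and> mx n < 2 ^ Suc (lev n)" by metis
  have bound: "sum c F \<le> c 0 + C / (1 - r)" if "finite F" for F
  proof -
    define F' where "F' = F - {0}"
    have "finite F'" using that by (simp add: F'_def)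
    obtain M where M: "lev ` F' \<subseteq> {..<M}"
      using finite_nat_set_iff_bounded [of "lev ` F'"] \<open>finite F'\<close> by auto
    have "sum c F \<le> c 0 + sum c F'"
    proof (cases "0 \<in> F")
      case True
      then show ?thesis using that by (simp add: F'_def sum.remove)
    next
      case False
      then show ?thesis using that by (simp add: F'_def c_def)
    qed
    \<comment> \<open>Sorting by shell: \<open>lev\<close> is constant on each group, so
      \<open>shell\<close> applies and a geometric series dominates. The index 0 lies in no shell
      and was split off.\<close>
    also have "sum c F' = (\<Sum>m<M. sum c {n \<in> F'. lev n = m})"
      using sum.group [OF \<open>finite F'\<close> _ M, of c] by simp
    also have "\<dots> \<le> (\<Sum>m<M. C * r ^ m)"
      by (intro sum_mono shell) (use \<open>finite F'\<close> lev in \<open>auto simp: F'_def\<close>)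
    also have "\<dots> \<le> (\<Sum>m. C * r ^ m)"
      using r \<open>C \<ge> 0\<close> by (intro sum_le_suminf summable_mult summable_geometric) auto
    also have "\<dots> = C / (1 - r)"
      using r by (simp add: suminf_mult summable_geometric suminf_geometric)
    finally show ?thesis by simp
  qed
  have "c summable_on UNIV"
  proof (rule nonneg_bdd_above_summable_on)
    show "bdd_above (sum c ` {F. F \<subseteq> UNIV \<and> finite F})"
      by (rule bdd_aboveI2 [of _ _ "c 0 + C / (1 - r)"]) (use bound in auto)
  qed (simp add: c_def)
  then show ?thesis by (simp add: c_def [abs_def])
qed

section \<open>Smooth functions near the sphere\<close>

text \<open>The \<open>closed_segment\<close> leaves the order of the endpoints free, since
  coordinate increments of either sign occur below; otherwise this is the mean value
  inequality.\<close>

lemma norm_diff_le_segment: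
  fixes u :: "real \<Rightarrow> 'a::real_normed_vector"
  assumes "\<And>s. s \<in> closed_segment a b \<Longrightarrow> (u has_vector_derivative u' s) (at s)"
    and "\<And>s. s \<in> closed_segment a b \<Longrightarrow> norm (u' s) \<le> B"
  shows "norm (u b - u a) \<le> B * \<bar>b - a\<bar>"
proof -
  have "norm (u b - u a) \<le> B * norm (b - a)"
  proof (rule differentiable_bound [OF convex_closed_segment])
    fix s assume s: "s \<in> closed_segment a b"
    show "(u has_derivative (\<lambda>h. h *\<^sub>R u' s)) (at s within closed_segment a b)"
      using assms(1) [OF s] by (auto simp: has_vector_derivative_def intro: has_derivative_at_withinI)
    show "onorm (\<lambda>h. h *\<^sub>R u' s) \<le> B"
      using assms(2) [OF s] by (simp add: onorm_scaleR_left onorm_id)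
  qed auto
  then show ?thesis by simp
qed

text \<open>Go from \<open>x\<close> to \<open>y\<close> one coordinate at a time. On each edge the
  mean value inequality compares a partial derivative at nearby points with its value at
  \<open>x\<close>.\<close>

lemma has_derivative_of_continuous_partials:
  fixes g :: "real^'n \<Rightarrow> 'a::real_normed_vector"
  assumes U: "open U" "x \<in> U"
    and der: "\<And>i y. y \<in> U \<Longrightarrow> ((\<lambda>t. g (y + t *\<^sub>R axis i 1)) has_vector_derivative D i y) (at 0)"
    and cont: "\<And>i. continuous_on U (D i)"
  shows "(g has_derivative (\<lambda>h. \<Sum>i\<in>UNIV. (h $ i) *\<^sub>R D i x)) (at x)"
  unfolding has_derivative_at_alt
proof (intro conjI allI impI)
  show "bounded_linear (\<lambda>h. \<Sum>i\<in>UNIV. (h $ i) *\<^sub>R D i x)"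
    by (intro bounded_linear_sum bounded_linear_compose [OF bounded_linear_scaleR_left bounded_linear_vec_nth])
  fix e :: real assume "e > 0"
  \<comment> \<open>One share of the error for each of the \<open>CARD('n)\<close> edges.\<close>
  define e' where "e' = e / real CARD('n)"
  have "e' > 0" using \<open>e > 0\<close> by (simp add: e'_def)
  obtain r where r: "r > 0" "ball x r \<subseteq> U" using U openE by blast
  have "\<exists>d>0. \<forall>y. dist y x < d \<longrightarrow> dist (D i y) (D i x) < e'" for i
    using cont [of i] U \<open>e' > 0\<close> by (metis continuous_at_eps_delta continuous_on_eq_continuous_at)
  then obtain d where d: "\<And>i. d i > 0" "\<And>i y. dist y x < d i \<Longrightarrow> dist (D i y) (D i x) < e'"
    by metis
  define \<delta> where "\<delta> = Min (insert r (range d))"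
  have \<delta>: "\<delta> > 0" "\<delta> \<le> r" "\<And>i. \<delta> \<le> d i"
    using r d Min_le [of "insert r (range d)"] by (auto simp: \<delta>_def simp del: Min_insert)
  have "norm (g y - g x - (\<Sum>i\<in>UNIV. ((y - x) $ i) *\<^sub>R D i x)) \<le> e * norm (y - x)" if y: "norm (y - x) < \<delta>" for y
  proof -
    define h where "h = y - x"
    \<comment> \<open>The corner reached once the coordinates in \<open>S\<close> have been moved
      from those of \<open>x\<close> to those of \<open>y\<close>.\<close>
    define p where "p S = x + (\<Sum>i\<in>S. (h $ i) *\<^sub>R axis i 1)" for S
    have comp: "(\<Sum>i\<in>S. (h $ i) *\<^sub>R axis i 1) $ k = (if k \<in> S then h $ k else 0)" for S k
      by (simp add: sum_component axis_def if_distrib cong: if_cong)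
    have "norm (g (p S) - g x - (\<Sum>i\<in>S. (h $ i) *\<^sub>R D i x)) \<le> real (card S) * (e' * norm h)" if "finite S" for S
      using that
    proof (induction S rule: finite_induct)
      case empty
      then show ?case by (simp add: p_def)
    next
      case (insert j S)
      \<comment> \<open>With the linear term subtracted, the derivative of \<open>u\<close> is the
        difference between \<open>D j\<close> at the moving point and at \<open>x\<close>.\<close>
      define u where "u t = g (p S + t *\<^sub>R axis j 1) - t *\<^sub>R D j x" for t
      have "norm (u (h $ j) - u 0) \<le> e' * \<bar>h $ j - 0\<bar>"
      proof (rule norm_diff_le_segment)
        fix s assume s: "s \<in> closed_segment 0 (h $ j)"
        define z where "z = p S + s *\<^sub>R axis j 1"
        \<comment> \<open>No coordinate has moved further than that of \<open>h\<close>, so the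
          whole path stays within \<open>\<delta>\<close> of \<open>x\<close>.\<close>
        have "\<bar>(z - x) $ k\<bar> \<le> \<bar>h $ k\<bar>" for k
        proof -
          have "(z - x) $ k = (if k \<in> S then h $ k else 0) + (if k = j then s else 0)"
          proof -
            have "z - x = (\<Sum>i\<in>S. (h $ i) *\<^sub>R axis i 1) + s *\<^sub>R axis j 1" by (simp add: z_def p_def)
            then show ?thesis
              by (simp only: vector_add_component comp vector_scaleR_component) (simp add: axis_def)
          qed
          then show ?thesis
            using s \<open>j \<notin> S\<close> by (auto simp: closed_segment_eq_real_ivl split: if_splits)
        qed
        then have "norm (z - x) \<le> norm h"
          by (intro norm_le_componentwise_cart) auto
        then have zx: "dist z x < \<delta>" using y by (simp add: h_def dist_norm)
        then have "z \<in> U" using r \<delta> by (auto simp: dist_commute)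
        have "((\<lambda>t. g (z + t *\<^sub>R axis j 1)) has_vector_derivative D j z) (at (s - s))"
          using der [OF \<open>z \<in> U\<close>] by simp
        then have "((\<lambda>t. g (z + t *\<^sub>R axis j 1)) \<circ> (\<lambda>t. t - s) has_vector_derivative (1 *\<^sub>R D j z)) (at s)"
          by (intro vector_diff_chain_at) (auto intro!: derivative_eq_intros)
        then have "((\<lambda>t. g (p S + t *\<^sub>R axis j 1)) has_vector_derivative D j z) (at s)"
          by (simp add: o_def z_def algebra_simps)
        then show "(u has_vector_derivative D j z - D j x) (at s)"
          unfolding u_def by (auto intro!: derivative_eq_intros)
        have "dist (D j z) (D j x) < e'" using zx \<delta>(3) d(2) less_le_trans by blast
        then show "norm (D j z - D j x) \<le> e'" by (simp add: dist_norm)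
      qed
      also have "\<dots> \<le> e' * norm h"
        using \<open>e' > 0\<close> component_le_norm_cart [of h j] by simp
      finally have "norm (u (h $ j) - u 0) \<le> e' * norm h" .
      moreover have "g (p (insert j S)) - g x - (\<Sum>i\<in>insert j S. (h $ i) *\<^sub>R D i x)
          = (u (h $ j) - u 0) + (g (p S) - g x - (\<Sum>i\<in>S. (h $ i) *\<^sub>R D i x))"
        using insert.hyps by (simp add: u_def p_def algebra_simps)
      ultimately have "norm (g (p (insert j S)) - g x - (\<Sum>i\<in>insert j S. (h $ i) *\<^sub>R D i x))
          \<le> e' * norm h + real (card S) * (e' * norm h)"
        using insert.IH by (simp only:) (rule norm_triangle_mono)
      then show ?case using insert.hyps by (simp add: algebra_simps)
    qed
    from this [of UNIV] have "norm (g (p UNIV) - g x - (\<Sum>i\<in>UNIV. (h $ i) *\<^sub>R D i x)) \<le> e * norm h"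
      by (simp add: e'_def)
    moreover have "p UNIV = y"
      using comp [of UNIV] by (simp add: p_def vec_eq_iff h_def)
    ultimately show ?thesis by (simp add: h_def)
  qed
  then show "\<exists>d>0. \<forall>y. norm (y - x) < d \<longrightarrow>
      norm (g y - g x - (\<Sum>i\<in>UNIV. ((y - x) $ i) *\<^sub>R D i x)) \<le> e * norm (y - x)"
    using \<delta>(1) by blast
qed

section \<open>Functions of class C^k: total derivatives and Lipschitz bounds\<close>

lemma Ck_open_mono: "Ck_open k U g \<Longrightarrow> j \<le> k \<Longrightarrow> Ck_open j U g"
  unfolding Ck_open_def by (meson le_trans less_le_trans)

lemma Ck_open_pdiff: "Ck_open (Suc k) U g \<Longrightarrow> Ck_open k U (pdiff i g)"
proof -
  assume g: "Ck_open (Suc k) U g"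
  \<comment> \<open>\<open>foldr\<close> applies the last letter of the word first, so a derivative
    taken beforehand is appended at the end.\<close>
  have "Dw ds (pdiff i g) = Dw (ds @ [i]) g" for ds by (simp add: Dw_def)
  then show ?thesis using g unfolding Ck_open_def by simp
qed

lemma Ck_open_imp_bounded: "Ck_open k U g \<Longrightarrow> bounded (g ` U)"
  unfolding Ck_open_def by (metis Dw_def foldr_Nil id_apply le0 list.size(3))

lemma Ck_open_imp_continuous_on: "Ck_open k U g \<Longrightarrow> continuous_on U g"
  unfolding Ck_open_def
  by (metis Dw_def foldr_Nil id_apply le0 list.size(3) uniformly_continuous_imp_continuous)

text \<open>\<open>Ck_open\<close> speaks of partial derivatives only; their continuity yields the
  total derivative that the chain rule needs.\<close>

lemma Ck_open_has_derivative:
  assumes "open U" "x \<in> U" and g: "Ck_open (Suc k) U g"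
  shows "(g has_derivative (\<lambda>h. \<Sum>i\<in>UNIV. (h $ i) *\<^sub>R pdiff i g x)) (at x)"
proof (rule has_derivative_of_continuous_partials [OF assms(1,2)])
  fix i y assume "y \<in> U"
  have "\<forall>i. \<forall>x\<in>U. (\<lambda>t::real. Dw [] g (x + t *\<^sub>R axis i 1)) differentiable (at 0)"
    using g unfolding Ck_open_def by (metis list.size(3) zero_less_Suc)
  then have "(\<lambda>t::real. g (y + t *\<^sub>R axis i 1)) differentiable (at 0)"
    using \<open>y \<in> U\<close> by (simp add: Dw_def)
  then show "((\<lambda>t. g (y + t *\<^sub>R axis i 1)) has_vector_derivative pdiff i g y) (at 0)"
    by (simp add: pdiff_def vector_derivative_works)
next
  show "continuous_on U (pdiff i g)" for i
    using Ck_open_imp_continuous_on [OF Ck_open_pdiff [OF g]] .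
qed

text \<open>For close points the segment joining them stays in \<open>U\<close>; for the others boundedness suffices.\<close>
lemma Ck_open_imp_Lipschitz_on_compact:
  assumes U: "open U" "K \<subseteq> U" "compact K" and g: "Ck_open (Suc k) U g"
  obtains L where "L \<ge> 0" "\<And>x y. x \<in> K \<Longrightarrow> y \<in> K \<Longrightarrow> norm (g x - g y) \<le> L * dist x y"
proof -
  have "\<exists>B>0. \<forall>x\<in>U. norm (pdiff i g x) \<le> B" for i
    using Ck_open_imp_bounded [OF Ck_open_pdiff [OF g]] unfolding bounded_pos by auto
  then obtain B where B: "\<And>i. B i > 0" "\<And>i x. x \<in> U \<Longrightarrow> norm (pdiff i g x) \<le> B i" by metis
  obtain B0 where B0: "B0 > 0" "\<And>x. x \<in> U \<Longrightarrow> norm (g x) \<le> B0"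
    using Ck_open_imp_bounded [OF g] unfolding bounded_pos by auto
  obtain \<delta> where \<delta>: "\<delta> > 0" "(\<Union>x\<in>K. ball x \<delta>) \<subseteq> U"
    using compact_subset_open_imp_ball_epsilon_subset [OF U(3,1,2)] by blast
  \<comment> \<open>The first summand serves points closer than \<open>\<delta>\<close>, the second
    all others, for which \<open>2 * B0\<close> is at most
    \<open>2 * B0 / \<delta> * dist x y\<close>.\<close>
  define L where "L = (\<Sum>i\<in>UNIV. B i) + 2 * B0 / \<delta>"
  have "sum B UNIV \<ge> 0" using B(1) by (simp add: sum_nonneg less_imp_le)
  show thesis
  proof (rule that)
    show "L \<ge> 0" using \<open>sum B UNIV \<ge> 0\<close> B0 \<delta> by (simp add: L_def)
    fix x y assume xy: "x \<in> K" "y \<in> K"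
    show "norm (g x - g y) \<le> L * dist x y"
    proof (cases "dist x y < \<delta>")
      case True
      have sub: "ball x \<delta> \<subseteq> U" using \<delta> xy by blast
      have "norm (g x - g y) \<le> sum B UNIV * norm (x - y)"
      proof (rule differentiable_bound [OF convex_ball [of x \<delta>]])
        fix z assume z: "z \<in> ball x \<delta>"
        then have "z \<in> U" using sub by blast
        show "(g has_derivative (\<lambda>h. \<Sum>i\<in>UNIV. (h $ i) *\<^sub>R pdiff i g z)) (at z within ball x \<delta>)"
          using Ck_open_has_derivative [OF U(1) \<open>z \<in> U\<close> g] by (rule has_derivative_at_withinI)
        show "onorm (\<lambda>h. \<Sum>i\<in>UNIV. (h $ i) *\<^sub>R pdiff i g z) \<le> sum B UNIV"
        proof (rule onorm_le)
          fix h :: "real^3"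
          have "norm (\<Sum>i\<in>UNIV. (h $ i) *\<^sub>R pdiff i g z) \<le> (\<Sum>i\<in>UNIV. B i * norm h)"
          proof (rule sum_norm_le)
            fix i
            have "norm ((h $ i) *\<^sub>R pdiff i g z) = norm (pdiff i g z) * \<bar>h $ i\<bar>" by simp
            also have "\<dots> \<le> B i * norm h"
              using B \<open>z \<in> U\<close> component_le_norm_cart [of h i] by (intro mult_mono) (auto simp: less_imp_le)
            finally show "norm ((h $ i) *\<^sub>R pdiff i g z) \<le> B i * norm h" .
          qed
          then show "norm (\<Sum>i\<in>UNIV. (h $ i) *\<^sub>R pdiff i g z) \<le> sum B UNIV * norm h"
            by (simp add: sum_distrib_right)
        qed
      qed (use True \<delta> in auto)
      also have "\<dots> \<le> L * dist x y"
        unfolding dist_norm by (rule mult_right_mono) (use B0 \<delta> in \<open>auto simp: L_def\<close>)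
      finally show ?thesis .
    next
      case False
      have "norm (g x - g y) \<le> 2 * B0"
        using B0(2) [of x] B0(2) [of y] xy U(2) norm_triangle_ineq4 [of "g x" "g y"] by force
      also have "\<dots> = 2 * B0 / \<delta> * \<delta>" using \<delta> by simp
      also have "\<dots> \<le> L * dist x y"
        using False \<delta> B0 \<open>sum B UNIV \<ge> 0\<close> by (intro mult_mono) (auto simp: L_def)
      finally show ?thesis .
    qed
  qed
qed

text \<open>Brings all admissible \<open>k\<close> and \<open>\<alpha>\<close> into one form. If
  \<open>k\<close> is at least 2 or \<open>\<alpha> = 1\<close>, second derivatives make the
  partials Lipschitz on the sphere, so \<open>\<beta> = 1\<close>; otherwise
  \<open>\<beta> = \<alpha>\<close>.\<close>

lemma Ckalpha_sphere_extension:
  assumes "k \<ge> 1" "0 < \<alpha>" "\<alpha> \<le> 1" and f: "Ckalpha_sphere k \<alpha> f"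
  obtains U g \<beta> C where "open U" "S2 \<subseteq> U" "Ck_open 1 U g" "\<And>\<xi>. \<xi> \<in> S2 \<Longrightarrow> g \<xi> = f \<xi>"
    "0 < \<beta>" "\<beta> \<le> 1" "C \<ge> 0"
    "\<And>i x y. x \<in> S2 \<Longrightarrow> y \<in> S2 \<Longrightarrow> norm (pdiff i g x - pdiff i g y) \<le> C * dist x y powr \<beta>"
proof -
  note extension = that
  have pd: "pdiff i g = Dw [i] g" for i g by (simp add: Dw_def)
  have smooth: thesis if U: "open U" "S2 \<subseteq> U" and g: "Ck_open 2 U g" and eq: "\<forall>\<xi>\<in>S2. g \<xi> = f \<xi>" for U g
  proof -
    have g1: "Ck_open (Suc 0) U (pdiff i g)" for i
      using Ck_open_pdiff [of "Suc 0" U g i] g by (simp add: numeral_2_eq_2)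
    have "\<exists>L\<ge>0. \<forall>x\<in>S2. \<forall>y\<in>S2. norm (pdiff i g x - pdiff i g y) \<le> L * dist x y" for i
      using Ck_open_imp_Lipschitz_on_compact [OF U compact_sphere g1 [of i]] by metis
    then obtain L where L: "\<And>i. L i \<ge> 0"
      "\<And>i x y. x \<in> S2 \<Longrightarrow> y \<in> S2 \<Longrightarrow> norm (pdiff i g x - pdiff i g y) \<le> L i * dist x y" by metis
    show thesis
    proof (rule extension [OF U Ck_open_mono [OF g], of 1 "sum L UNIV"])
      fix i x y assume xy: "x \<in> S2" "y \<in> S2"
      have "L i \<le> sum L UNIV" using L(1) by (intro member_le_sum) auto
      then have "L i * dist x y \<le> sum L UNIV * dist x y" by (rule mult_right_mono) simp
      then show "norm (pdiff i g x - pdiff i g y) \<le> sum L UNIV * dist x y powr 1"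
        using L(2) [OF xy, of i] by simp
    qed (use eq L(1) in \<open>auto intro: sum_nonneg\<close>)
  qed
  show thesis
  proof (cases "\<alpha> = 1")
    case True
    then obtain U g where "open U" "S2 \<subseteq> U" "Ck_open (k+1) U g" "\<forall>\<xi>\<in>S2. g \<xi> = f \<xi>"
      using f unfolding Ckalpha_sphere_def by auto
    then show thesis using smooth Ck_open_mono [of "k+1" U g 2] \<open>k \<ge> 1\<close> by auto
  next
    case False
    then obtain U g where U: "open U" "S2 \<subseteq> U" and g: "Ckalpha_open k \<alpha> U g" and eq: "\<forall>\<xi>\<in>S2. g \<xi> = f \<xi>"
      using f \<open>0 < \<alpha>\<close> unfolding Ckalpha_sphere_def by auto
    show thesis
    proof (cases "k = 1")
      case True
      then obtain C where C: "\<forall>ds. length ds = 1 \<longrightarrow> (\<forall>x\<in>U. \<forall>y\<in>U. x \<noteq> y \<longrightarrow>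
         norm (Dw ds g x - Dw ds g y) \<le> C * dist x y powr \<alpha>)" and g1: "Ck_open 1 U g"
        using g unfolding Ckalpha_open_def by auto
      show thesis
      \<comment> \<open>The constant in \<open>Ckalpha_open\<close> has no prescribed sign, hence
        the absolute value.\<close>
      proof (rule extension [OF U g1, of \<alpha> "\<bar>C\<bar>"])
        fix i x y assume xy: "x \<in> S2" "y \<in> S2"
        show "norm (pdiff i g x - pdiff i g y) \<le> \<bar>C\<bar> * dist x y powr \<alpha>"
        proof (cases "x = y")
          case False
          then have "norm (pdiff i g x - pdiff i g y) \<le> C * dist x y powr \<alpha>"
            using C xy U(2) unfolding pd by (auto simp: subset_iff)
          also have "\<dots> \<le> \<bar>C\<bar> * dist x y powr \<alpha>" by (rule mult_right_mono) auto
          finally show ?thesis .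
        qed simp
      qed (use eq assms in auto)
    next
      case False
      then have "Ck_open 2 U g"
        using g \<open>k \<ge> 1\<close> Ck_open_mono [of k U g 2] unfolding Ckalpha_open_def by auto
      then show thesis using smooth U eq by blast
    qed
  qed
qed

text \<open>The second difference is the increment of the even function
  \<open>v s = u s + u (- s)\<close>, whose derivative is \<open>u' s - u' (- s)\<close>;
  integrating its Hoelder bound gains one power of \<open>t\<close>.\<close>

lemma norm_second_difference_le:
  fixes u :: "real \<Rightarrow> 'a::real_normed_vector"
  assumes der: "\<And>s. (u has_vector_derivative u' s) (at s)"
    and "0 < t" "0 \<le> \<beta>" "K \<ge> 0"
    and hol: "\<And>s. 0 \<le> s \<Longrightarrow> s \<le> t \<Longrightarrow> norm (u' s - u' (- s)) \<le> K * s powr \<beta>"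
  shows "norm (u t - 2 *\<^sub>R u 0 + u (- t)) \<le> K * t powr (1 + \<beta>)"
proof -
  define v where "v s = u s + u (- s)" for s
  have "norm (v t - v 0) \<le> (K * t powr \<beta>) * \<bar>t - 0\<bar>"
  proof (rule norm_diff_le_segment)
    fix s assume s: "s \<in> closed_segment 0 t"
    have "(u \<circ> uminus has_vector_derivative ((- 1) *\<^sub>R u' (- s))) (at s)"
      by (rule vector_diff_chain_at) (auto intro!: derivative_eq_intros der)
    then show "(v has_vector_derivative (u' s - u' (- s))) (at s)"
      unfolding v_def using has_vector_derivative_add [OF der [of s]] by (fastforce simp: o_def)
    have "0 \<le> s" "s \<le> t" using s \<open>0 < t\<close> by (auto simp: closed_segment_eq_real_ivl)
    then have "K * s powr \<beta> \<le> K * t powr \<beta>"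
      using assms by (intro mult_left_mono powr_mono2) auto
    then show "norm (u' s - u' (- s)) \<le> K * t powr \<beta>"
      using hol [OF \<open>0 \<le> s\<close> \<open>s \<le> t\<close>] by linarith
  qed
  also have "\<dots> = K * t powr (1 + \<beta>)" using \<open>0 < t\<close> by (simp add: powr_add)
  finally show ?thesis by (simp add: v_def scaleR_2 algebra_simps)
qed

text \<open>The variation of the derivative of \<open>g \<circ> \<gamma>\<close> splits into that of
  the velocity, which is Lipschitz, and that of the partials, which is Hoelder. \<open>K\<close> is
  chosen before the curve, so the bound will be uniform over the torus.\<close>

lemma second_difference_along_curves:
  assumes U: "open U" "S2 \<subseteq> U" and g: "Ck_open 1 U g" and \<beta>: "0 < \<beta>" "\<beta> \<le> 1" and "C \<ge> 0"
    and hol: "\<And>i x y. x \<in> S2 \<Longrightarrow> y \<in> S2 \<Longrightarrow> norm (pdiff i g x - pdiff i g y) \<le> C * dist x y powr \<beta>"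
  obtains K where "\<And>\<gamma> \<gamma>' \<gamma>'' t. \<lbrakk>\<And>s. \<gamma> s \<in> S2;
      \<And>s. (\<gamma> has_vector_derivative \<gamma>' s) (at s); \<And>s. (\<gamma>' has_vector_derivative \<gamma>'' s) (at s);
      \<And>s. norm (\<gamma>' s) \<le> 1; \<And>s. norm (\<gamma>'' s) \<le> 1; 0 < t; t \<le> 2\<rbrakk>
      \<Longrightarrow> norm (g (\<gamma> t) - 2 * g (\<gamma> 0) + g (\<gamma> (- t))) \<le> K * t powr (1 + \<beta>)"
proof -
  have g': "Ck_open (Suc 0) U g" using g by simp
  have "\<exists>B>0. \<forall>x\<in>U. norm (pdiff i g x) \<le> B" for i
    using Ck_open_imp_bounded [OF Ck_open_pdiff [OF g']] unfolding bounded_pos by auto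
  then obtain B0 where B0: "\<And>i. B0 i > 0" "\<And>i x. x \<in> U \<Longrightarrow> norm (pdiff i g x) \<le> B0 i" by metis
  define B where "B = sum B0 UNIV"
  have B: "norm (pdiff i g x) \<le> B" if "x \<in> U" for i x
  proof -
    have "B0 i \<le> B" unfolding B_def using B0(1) by (intro member_le_sum) (auto simp: less_imp_le)
    then show ?thesis using B0(2) [OF that, of i] by linarith
  qed
  have "B \<ge> 0" unfolding B_def using B0(1) by (intro sum_nonneg) (auto simp: less_imp_le)
  \<comment> \<open>The 3 counts coordinates; \<open>4 * B\<close> arises from
    \<open>2 * s * B\<close> and \<open>s\<beta>\<close>, and \<open>2 * C\<close> from
    \<open>l2\<close>.\<close>
  define K where "K = 3 * (4 * B + 2 * C)"
  have "K \<ge> 0" using \<open>B \<ge> 0\<close> \<open>C \<ge> 0\<close> by (simp add: K_def)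
  show thesis
  proof (rule that [of K])
    fix \<gamma> \<gamma>' \<gamma>'' :: "real \<Rightarrow> real^3" and t :: real
    assume S: "\<And>s. \<gamma> s \<in> S2"
      and d: "\<And>s. (\<gamma> has_vector_derivative \<gamma>' s) (at s)" "\<And>s. (\<gamma>' has_vector_derivative \<gamma>'' s) (at s)"
      and n: "\<And>s. norm (\<gamma>' s) \<le> 1" "\<And>s. norm (\<gamma>'' s) \<le> 1" and t: "0 < t" "t \<le> 2"
    have SU: "\<gamma> s \<in> U" for s using S U by blast
    define u' where "u' s = (\<Sum>i\<in>UNIV. (\<gamma>' s $ i) *\<^sub>R pdiff i g (\<gamma> s))" for s
    have "norm ((g \<circ> \<gamma>) t - 2 *\<^sub>R (g \<circ> \<gamma>) 0 + (g \<circ> \<gamma>) (- t)) \<le> K * t powr (1 + \<beta>)"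
    proof (rule norm_second_difference_le [where u' = u'])
      show "((g \<circ> \<gamma>) has_vector_derivative u' s) (at s)" for s
        unfolding u'_def
        by (rule vector_derivative_diff_chain_within [OF d(1) has_derivative_at_withinI [OF Ck_open_has_derivative [OF U(1) SU g']]])
      fix s assume s: "0 \<le> s" "s \<le> t"
      have l0: "norm (\<gamma> s - \<gamma> (- s)) \<le> 2 * s"
        using norm_diff_le_segment [of "- s" s \<gamma> \<gamma>' 1] d n s by simp
      have l1: "norm (\<gamma>' s - \<gamma>' (- s)) \<le> 2 * s"
        using norm_diff_le_segment [of "- s" s \<gamma>' \<gamma>'' 1] d n s by simp
      \<comment> \<open>Here \<open>t \<le> 2\<close> enters: on a bounded range the Lipschitz bound
        \<open>s\<close> is absorbed by the weaker Hoelder power.\<close>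
      have s\<beta>: "s \<le> 2 * s powr \<beta>"
      proof (cases "s = 0")
        case False
        have "s powr (1 - \<beta>) \<le> 2 powr (1 - \<beta>)" using s t \<beta> by (intro powr_mono2) auto
        also have "\<dots> \<le> 2 powr 1" using \<beta> by (intro powr_mono) auto
        finally have "s powr \<beta> * s powr (1 - \<beta>) \<le> s powr \<beta> * 2" by (intro mult_left_mono) auto
        moreover have "s powr \<beta> * s powr (1 - \<beta>) = s"
          using False s by (simp flip: powr_add)
        ultimately show ?thesis by simp
      qed simp
      have "dist (\<gamma> s) (\<gamma> (- s)) powr \<beta> \<le> (2 * s) powr \<beta>"
        using l0 s \<beta> by (intro powr_mono2) (auto simp: dist_norm)
      also have "\<dots> = 2 powr \<beta> * s powr \<beta>" using s by (simp add: powr_mult)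
      also have "\<dots> \<le> 2 * s powr \<beta>"
        using powr_mono [of \<beta> 1 2] \<beta> by (intro mult_right_mono) auto
      finally have l2: "dist (\<gamma> s) (\<gamma> (- s)) powr \<beta> \<le> 2 * s powr \<beta>" .
      have "norm (u' s - u' (- s)) = norm (\<Sum>i\<in>UNIV. (\<gamma>' s $ i) *\<^sub>R pdiff i g (\<gamma> s) - (\<gamma>' (- s) $ i) *\<^sub>R pdiff i g (\<gamma> (- s)))"
        by (simp add: u'_def sum_subtractf)
      also have "\<dots> \<le> (\<Sum>i\<in>(UNIV::3 set). (4 * B + 2 * C) * s powr \<beta>)"
      proof (rule sum_norm_le)
        fix i :: 3
        have "norm ((\<gamma>' s $ i) *\<^sub>R pdiff i g (\<gamma> s) - (\<gamma>' (- s) $ i) *\<^sub>R pdiff i g (\<gamma> (- s)))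
          = norm (((\<gamma>' s - \<gamma>' (- s)) $ i) *\<^sub>R pdiff i g (\<gamma> s) + (\<gamma>' (- s) $ i) *\<^sub>R (pdiff i g (\<gamma> s) - pdiff i g (\<gamma> (- s))))"
          by (simp add: algebra_simps)
        also have "\<dots> \<le> \<bar>(\<gamma>' s - \<gamma>' (- s)) $ i\<bar> * norm (pdiff i g (\<gamma> s))
            + \<bar>\<gamma>' (- s) $ i\<bar> * norm (pdiff i g (\<gamma> s) - pdiff i g (\<gamma> (- s)))"
          by (rule norm_triangle_le) simp
        also have "\<dots> \<le> (2 * s) * B + 1 * (C * (2 * s powr \<beta>))"
        proof (intro add_mono mult_mono)
          show "\<bar>(\<gamma>' s - \<gamma>' (- s)) $ i\<bar> \<le> 2 * s"
            using component_le_norm_cart [of "\<gamma>' s - \<gamma>' (- s)" i] l1 s by linarith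
          show "\<bar>\<gamma>' (- s) $ i\<bar> \<le> 1"
            using component_le_norm_cart [of "\<gamma>' (- s)" i] n(1) [of "- s"] by linarith
          show "norm (pdiff i g (\<gamma> s) - pdiff i g (\<gamma> (- s))) \<le> C * (2 * s powr \<beta>)"
            using hol [OF S [of s] S [of "- s"], of i] mult_left_mono [OF l2 \<open>C \<ge> 0\<close>] by linarith
        qed (use B SU s in auto)
        also have "\<dots> \<le> (4 * B + 2 * C) * s powr \<beta>"
          using mult_left_mono [OF s\<beta> \<open>B \<ge> 0\<close>] by (simp add: algebra_simps)
        finally show "norm ((\<gamma>' s $ i) *\<^sub>R pdiff i g (\<gamma> s) - (\<gamma>' (- s) $ i) *\<^sub>R pdiff i g (\<gamma> (- s)))
          \<le> (4 * B + 2 * C) * s powr \<beta>" .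
      qed
      also have "\<dots> = K * s powr \<beta>" by (simp add: K_def)
      finally show "norm (u' s - u' (- s)) \<le> K * s powr \<beta>" .
    qed (use t \<beta> \<open>K \<ge> 0\<close> in auto)
    then show "norm (g (\<gamma> t) - 2 * g (\<gamma> 0) + g (\<gamma> (- t))) \<le> K * t powr (1 + \<beta>)"
      by (simp add: scaleR_conv_of_real)
  qed
qed

section \<open>The double Fourier sphere map\<close>

lemma phi_nth [simp]:
  "phi (l, t) $ 1 = cos l * sin t" "phi (l, t) $ 2 = sin l * sin t" "phi (l, t) $ 3 = cos t"
  by (simp_all add: phi_def)

lemma phi_eq: "phi (l, t) = (cos l * sin t) *\<^sub>R axis 1 1 + (sin l * sin t) *\<^sub>R axis 2 1 + cos t *\<^sub>R axis 3 1"
  by (simp add: vec_eq_iff forall_3 axis_def)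

lemma norm_phi [simp]: "norm (phi p) = 1"
proof -
  obtain l t where p: "p = (l, t)" by (cases p)
  have "(norm (phi p))\<^sup>2 = (cos l * sin t)\<^sup>2 + (sin l * sin t)\<^sup>2 + (cos t)\<^sup>2"
    unfolding power2_norm_eq_inner inner_vec_def sum_3 p by (simp add: power2_eq_square)
  also have "\<dots> = ((cos l)\<^sup>2 + (sin l)\<^sup>2) * (sin t)\<^sup>2 + (cos t)\<^sup>2"
    by (simp add: power_mult_distrib algebra_simps del: sin_cos_squared_add sin_cos_squared_add2)
  finally show ?thesis by (simp add: power2_eq_1_iff) (metis norm_ge_zero not_one_le_zero neg_0_le_iff_le)
qed

text \<open>Differentiation is expressed as a quarter turn of the argument of \<open>phi\<close>. So
  \<open>norm_phi\<close> bounds the derivative, and the same rule differentiates it again.\<close>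

lemma phi_has_vector_derivative_1:
  "((\<lambda>s. phi (a + s, b)) has_vector_derivative sin b *\<^sub>R phi (a + s + pi/2, pi/2)) (at s)"
  unfolding phi_eq
  by (auto intro!: derivative_eq_intros simp: has_real_derivative_iff_has_vector_derivative [symmetric]
      cos_add sin_add algebra_simps)

lemma phi_has_vector_derivative_2:
  "((\<lambda>s. phi (a, b + s)) has_vector_derivative phi (a, b + s + pi/2)) (at s)"
  unfolding phi_eq
  by (auto intro!: derivative_eq_intros simp: has_real_derivative_iff_has_vector_derivative [symmetric]
      cos_add sin_add algebra_simps)

text \<open>In the first two coordinates both factors change sign, and cosine is even in the
  third.\<close>

lemma phi_glide: "phi (fst x + pi, - snd x) = phi x"
  by (cases x) (simp add: phi_eq)

text \<open>Coordinate lines of the torus are mapped to parallels, possibly shrunk to a pole, and to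
  meridians; in these parametrisations velocity and acceleration have norm at most 1.\<close>

lemma dfs_second_difference:
  assumes "k \<ge> 1" "0 < \<alpha>" "\<alpha> \<le> 1" and f: "Ckalpha_sphere k \<alpha> f"
  obtains \<beta> K where "0 < \<beta>"
    "\<And>x t. 0 < t \<Longrightarrow> t \<le> 2 \<Longrightarrow> norm (dfs f (x + (t,0)) - 2 * dfs f x + dfs f (x - (t,0))) \<le> K * t powr (1 + \<beta>)"
    "\<And>x t. 0 < t \<Longrightarrow> t \<le> 2 \<Longrightarrow> norm (dfs f (x + (0,t)) - 2 * dfs f x + dfs f (x - (0,t))) \<le> K * t powr (1 + \<beta>)"
proof -
  obtain U g \<beta> C where U: "open U" "S2 \<subseteq> U" "Ck_open 1 U g" and eq: "\<And>\<xi>. \<xi> \<in> S2 \<Longrightarrow> g \<xi> = f \<xi>"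
    and \<beta>: "0 < \<beta>" "\<beta> \<le> 1" "C \<ge> 0"
    and hol: "\<And>i x y. x \<in> S2 \<Longrightarrow> y \<in> S2 \<Longrightarrow> norm (pdiff i g x - pdiff i g y) \<le> C * dist x y powr \<beta>"
    using Ckalpha_sphere_extension [OF assms] by blast
  obtain K where K: "\<And>\<gamma> \<gamma>' \<gamma>'' t. \<lbrakk>\<And>s. \<gamma> s \<in> S2;
      \<And>s. (\<gamma> has_vector_derivative \<gamma>' s) (at s); \<And>s. (\<gamma>' has_vector_derivative \<gamma>'' s) (at s);
      \<And>s. norm (\<gamma>' s) \<le> 1; \<And>s. norm (\<gamma>'' s) \<le> 1; 0 < t; t \<le> 2\<rbrakk>
      \<Longrightarrow> norm (g (\<gamma> t) - 2 * g (\<gamma> 0) + g (\<gamma> (- t))) \<le> K * t powr (1 + \<beta>)"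
    using second_difference_along_curves [OF U \<beta> hol] by blast
  have gf: "g (phi p) = dfs f p" for p by (simp add: eq dfs_def)
  show thesis
  proof (rule that [OF \<beta>(1), of K])
    fix x :: "real \<times> real" and t :: real assume t: "0 < t" "t \<le> 2"
    obtain a b where x: "x = (a, b)" by (cases x)
    have "norm (g (phi (a + t, b)) - 2 * g (phi (a + 0, b)) + g (phi (a + (- t), b))) \<le> K * t powr (1 + \<beta>)"
    \<comment> \<open>The factor \<open>sin (pi/2)\<close>, equal to 1, is kept so that the
      derivative rule for parallels applies verbatim a second time.\<close>
    proof (rule K [where \<gamma>'' = "\<lambda>s. sin b *\<^sub>R sin (pi/2) *\<^sub>R phi ((a + pi/2) + s + pi/2, pi/2)"])
      fix s
      show "((\<lambda>s. phi (a + s, b)) has_vector_derivative sin b *\<^sub>R phi ((a + pi/2) + s, pi/2)) (at s)"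
        using phi_has_vector_derivative_1 [of a b s] by (simp add: add_ac)
      show "((\<lambda>s. sin b *\<^sub>R phi ((a + pi/2) + s, pi/2)) has_vector_derivative
          sin b *\<^sub>R sin (pi/2) *\<^sub>R phi ((a + pi/2) + s + pi/2, pi/2)) (at s)"
        using bounded_linear.has_vector_derivative [OF bounded_linear_scaleR_right
            phi_has_vector_derivative_1 [of "a + pi/2" "pi/2" s]] .
    qed (use t in auto)
    then show "norm (dfs f (x + (t,0)) - 2 * dfs f x + dfs f (x - (t,0))) \<le> K * t powr (1 + \<beta>)"
      by (simp add: gf x)
    have "norm (g (phi (a, b + t)) - 2 * g (phi (a, b + 0)) + g (phi (a, b + (- t)))) \<le> K * t powr (1 + \<beta>)"
    proof (rule K [where \<gamma>'' = "\<lambda>s. phi (a, (b + pi/2) + s + pi/2)"])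
      fix s
      show "((\<lambda>s. phi (a, b + s)) has_vector_derivative phi (a, (b + pi/2) + s)) (at s)"
        using phi_has_vector_derivative_2 [of a b s] by (simp add: add_ac)
      show "((\<lambda>s. phi (a, (b + pi/2) + s)) has_vector_derivative phi (a, (b + pi/2) + s + pi/2)) (at s)"
        by (rule phi_has_vector_derivative_2)
    qed (use t in auto)
    then show "norm (dfs f (x + (0,t)) - 2 * dfs f x + dfs f (x - (0,t))) \<le> K * t powr (1 + \<beta>)"
      by (simp add: gf x)
  qed
qed

lemma Ckalpha_sphere_imp_continuous_on:
  assumes "k \<ge> 1" "0 < \<alpha>" "\<alpha> \<le> 1" and f: "Ckalpha_sphere k \<alpha> f"
  shows "continuous_on S2 f"
proof (rule Ckalpha_sphere_extension [OF assms])
  fix U g assume U: "S2 \<subseteq> U" "Ck_open 1 U g" and eq: "\<And>\<xi>. \<xi> \<in> S2 \<Longrightarrow> g \<xi> = f \<xi>"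
  have "continuous_on S2 g"
    by (rule continuous_on_subset [OF Ck_open_imp_continuous_on [OF U(2)] U(1)])
  then show "continuous_on S2 f"
    by (rule continuous_on_eq) (rule eq)
qed

section \<open>Trigonometric approximation of DFS functions\<close>

lemma trig_poly_cos: "trig_poly (\<lambda>x. complex_of_real (cos (fst x)))" "trig_poly (\<lambda>x. complex_of_real (cos (snd x)))"
  and trig_poly_sin: "trig_poly (\<lambda>x. complex_of_real (sin (fst x)))" "trig_poly (\<lambda>x. complex_of_real (sin (snd x)))"
proof -
  have c: "trig_poly (\<lambda>x. complex_of_real (cos (ip n x)))" for n
  proof -
    have "complex_of_real (cos (ip n x)) = 1/2 * fexp n x + 1/2 * fexp (- n) x" for x
    proof -
      have "ip (- n) x = - ip n x" by (simp add: ip_def)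
      then show ?thesis by (simp add: fexp_def complex_eq_iff Re_exp Im_exp)
    qed
    then show ?thesis by (simp only:) (intro trig_poly.intros)
  qed
  have s: "trig_poly (\<lambda>x. complex_of_real (sin (ip n x)))" for n
  proof -
    have "complex_of_real (sin (ip n x)) = (- \<i>/2) * fexp n x + (\<i>/2) * fexp (- n) x" for x
    proof -
      have "ip (- n) x = - ip n x" by (simp add: ip_def)
      then show ?thesis by (simp add: fexp_def complex_eq_iff Re_exp Im_exp)
    qed
    then show ?thesis by (simp only:) (intro trig_poly.intros)
  qed
  show "trig_poly (\<lambda>x. complex_of_real (cos (fst x)))" "trig_poly (\<lambda>x. complex_of_real (cos (snd x)))"
    using c [of "(1,0)"] c [of "(0,1)"] by (simp_all add: ip_def)
  show "trig_poly (\<lambda>x. complex_of_real (sin (fst x)))" "trig_poly (\<lambda>x. complex_of_real (sin (snd x)))"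
    using s [of "(1,0)"] s [of "(0,1)"] by (simp_all add: ip_def)
qed

text \<open>A linear functional of \<open>phi\<close> combines its three components, each a
  trigonometric polynomial; closure under sums and products does the rest.\<close>

lemma trig_poly_real_polynomial_phi:
  "real_polynomial_function q \<Longrightarrow> trig_poly (\<lambda>x. complex_of_real (q (phi x)))"
proof (induction rule: real_polynomial_function.induct)
  case (linear q)
  interpret bounded_linear q by fact
  have "complex_of_real (q (phi x)) =
      complex_of_real (q (axis 1 1)) * (complex_of_real (cos (fst x)) * complex_of_real (sin (snd x)))
    + complex_of_real (q (axis 2 1)) * (complex_of_real (sin (fst x)) * complex_of_real (sin (snd x)))
    + complex_of_real (q (axis 3 1)) * complex_of_real (cos (snd x))" for x
    by (cases x) (simp add: phi_eq add scaleR)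
  then show ?case
    by (simp only:) (intro trig_poly.add trig_poly_mult trig_poly_const trig_poly_cos trig_poly_sin)
qed (auto intro: trig_poly_const trig_poly.add trig_poly_mult)

lemma trig_approx_dfs:
  assumes "continuous_on S2 f"
  shows "trig_approx (dfs f)"
  unfolding trig_approx_def
proof (intro allI impI)
  fix e :: real assume "e > 0"
  obtain p where p: "polynomial_function p" "\<And>x. x \<in> S2 \<Longrightarrow> norm (f x - p x) < e"
    using Stone_Weierstrass_polynomial_function [OF compact_sphere assms \<open>e > 0\<close>] by blast
  have "real_polynomial_function (\<lambda>x. Re (p x))" "real_polynomial_function (\<lambda>x. Im (p x))"
    using p(1) bounded_linear_Re bounded_linear_Im unfolding polynomial_function_def o_def by blast+
  then have "trig_poly (\<lambda>x. complex_of_real (Re (p (phi x))) + \<i> * complex_of_real (Im (p (phi x))))"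
    by (intro trig_poly.add trig_poly_mult trig_poly_const trig_poly_real_polynomial_phi)
  then have "trig_poly (\<lambda>x. p (phi x))" by (simp add: complex_eq [symmetric])
  then show "\<exists>T. trig_poly T \<and> (\<forall>x. norm (dfs f x - T x) \<le> e)"
    using p(2) by (intro exI [of _ "\<lambda>x. p (phi x)"]) (simp add: dfs_def less_imp_le)
qed

section \<open>Inverting the sphere map and transferring partial sums\<close>

lemma phi_inj_on: "inj_on phi phi_dom"
proof (rule inj_onI)
  fix p q assume p: "p \<in> phi_dom" and q: "q \<in> phi_dom" and eq: "phi p = phi q"
  obtain l t where pl: "p = (l, t)" by (cases p)
  obtain l' t' where ql: "q = (l', t')" by (cases q)
  have comp: "cos l * sin t = cos l' * sin t'" "sin l * sin t = sin l' * sin t'" "cos t = cos t'"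
    using eq phi_nth unfolding pl ql by metis+
  have "t \<in> {0..pi}" "t' \<in> {0..pi}" using p q by (auto simp: pl ql phi_dom_def)
  then have t: "t = t'" using comp(3) cos_inj_pi by auto
  show "p = q"
  proof (cases "t \<in> {0<..<pi}")
    case True
    then have "sin t \<noteq> 0" using sin_gt_zero by force
    then have "sin l = sin l' \<and> cos l = cos l'" using comp t by auto
    then obtain n :: int where n: "l = l' + 2 * pi * n" using sin_cos_eq_iff by blast
    have "l \<in> {-pi..<pi}" "l' \<in> {-pi..<pi}" using p q True t by (auto simp: pl ql phi_dom_def)
    \<comment> \<open>Both longitudes lie in one half-open interval of length 2 pi, so the multiple
      of 2 pi between them is 0.\<close>
    then have "\<bar>2 * pi * real_of_int n\<bar> < 2 * pi" using n by auto
    then have "\<bar>real_of_int n\<bar> < 1" by (simp add: abs_mult)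
    then have "n = 0" by linarith
    then show ?thesis using n t pl ql by simp
  next
    \<comment> \<open>At the poles the longitude is lost, but \<open>phi_dom\<close> keeps a single
      point over each of them.\<close>
    case False
    then show ?thesis using p q t by (auto simp: pl ql phi_dom_def)
  qed
qed

lemma S2_subset_phi_dom_image: "S2 \<subseteq> phi ` phi_dom"
proof
  fix \<xi> :: "real^3" assume "\<xi> \<in> S2"
  then have sq: "(\<xi> $ 1)\<^sup>2 + (\<xi> $ 2)\<^sup>2 + (\<xi> $ 3)\<^sup>2 = 1"
    by (simp add: norm_eq_1 inner_vec_def sum_3 power2_eq_square)
  then have "(\<xi> $ 3)\<^sup>2 \<le> 1"
    using sum_power2_ge_zero [of "\<xi> $ 1" "\<xi> $ 2"] by linarith
  then have "\<bar>\<xi> $ 3\<bar> \<le> 1" by (simp add: abs_square_le_1)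
  define t where "t = arccos (\<xi> $ 3)"
  have t: "cos t = \<xi> $ 3" "0 \<le> t" "t \<le> pi"
    using \<open>\<bar>\<xi> $ 3\<bar> \<le> 1\<close> by (auto simp: t_def arccos_lbound arccos_ubound)
  have sin2: "(sin t)\<^sup>2 = (\<xi> $ 1)\<^sup>2 + (\<xi> $ 2)\<^sup>2"
    using sq by (simp add: sin_squared_eq t)
  show "\<xi> \<in> phi ` phi_dom"
  proof (cases "t = 0 \<or> t = pi")
    case True
    then have "\<xi> $ 1 = 0" "\<xi> $ 2 = 0" using sin2 by (auto simp: sum_power2_eq_zero_iff)
    then have "phi (0, t) = \<xi>"
      using True t by (auto simp: vec_eq_iff forall_3)
    moreover have "(0, t) \<in> phi_dom" using True by (auto simp: phi_dom_def)
    ultimately show ?thesis by blast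
  next
    case False
    then have "sin t > 0" using t sin_gt_zero by auto
    then have "(\<xi> $ 1 / sin t)\<^sup>2 + (\<xi> $ 2 / sin t)\<^sup>2 = 1"
      by (simp add: power_divide sin2 [symmetric] flip: add_divide_distrib)
    then obtain l where l: "0 \<le> l" "l < 2*pi" "\<xi> $ 1 / sin t = cos l" "\<xi> $ 2 / sin t = sin l"
      using sincos_total_2pi by metis
    \<comment> \<open>The angle found lies in the interval from 0 to 2 pi, whereas
      \<open>phi_dom\<close> starts at - pi.\<close>
    define l' where "l' = (if l < pi then l else l - 2*pi)"
    have "cos l' = cos l" "sin l' = sin l" by (auto simp: l'_def cos_diff sin_diff)
    then have "phi (l', t) = \<xi>"
      using l t \<open>sin t > 0\<close> by (auto simp: vec_eq_iff forall_3 field_simps)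
    moreover have "(l', t) \<in> phi_dom" using l t False by (auto simp: phi_dom_def l'_def)
    ultimately show ?thesis by blast
  qed
qed

lemma phi_phi_inv:
  assumes "\<xi> \<in> S2"
  shows "phi (phi_inv \<xi>) = \<xi>"
proof -
  obtain p where p: "p \<in> phi_dom" "phi p = \<xi>"
    using assms S2_subset_phi_dom_image by blast
  then have "phi_inv \<xi> = p"
    unfolding phi_inv_def using phi_inj_on by (intro the_equality) (auto dest: inj_onD)
  then show ?thesis using p by simp
qed

text \<open>An index with \<open>snd n \<noteq> 0\<close> contributes the frequencies
  \<open>n\<close> and \<open>Mref n\<close>, the sign in \<open>en\<close> being absorbed by the
  symmetry of the coefficients. Indices with \<open>snd n = 0\<close> are fixed by
  \<open>Mref\<close> and count once; \<open>ZN0\<close> keeps the genuine mirror images disjoint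
  from \<open>\<Omega>\<close>.\<close>

lemma Spart_eq_Fpart:
  assumes f: "trig_approx (dfs f)" and \<Omega>: "finite \<Omega>" "\<Omega> \<subseteq> ZN0"
  shows "Spart \<Omega> f \<xi> = Fpart (\<Omega> \<union> Mref ` \<Omega>) (dfs f) (phi_inv \<xi>)"
proof -
  define T where "T n = fcoeff n (dfs f) * fexp n (phi_inv \<xi>)" for n
  define P where "P = {n \<in> \<Omega>. snd n \<noteq> 0}"
  have M: "fcoeff (Mref n) (dfs f) = (-1) ^ nat \<bar>fst n\<bar> * fcoeff n (dfs f)" for n
    by (rule fcoeff_Mref [OF f]) (simp add: dfs_def phi_glide)
  have "fcoeff n (dfs f) * bn n \<xi> = T n + (if snd n \<noteq> 0 then T (Mref n) else 0)" for n
    by (simp add: bn_def en_def T_def M fexp_def algebra_simps)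
  then have "Spart \<Omega> f \<xi> = sum T \<Omega> + (\<Sum>n\<in>P. T (Mref n))"
    using \<Omega>(1) by (simp add: Spart_def sum.distrib P_def sum.inter_filter)
  also have "(\<Sum>n\<in>P. T (Mref n)) = sum T (Mref ` P)"
    by (subst sum.reindex) (auto simp: inj_on_def Mref_def prod_eq_iff)
  also have "sum T \<Omega> + sum T (Mref ` P) = sum T (\<Omega> \<union> Mref ` P)"
  proof (rule sum.union_disjoint [symmetric])
    have "snd n \<ge> 0" if "n \<in> \<Omega>" for n using that \<Omega>(2) by (auto simp: ZN0_def)
    moreover have "snd n < 0" if "n \<in> Mref ` P" for n
      using that calculation by (force simp: P_def Mref_def)
    ultimately show "\<Omega> \<inter> Mref ` P = {}" by force
  qed (use \<Omega>(1) in \<open>auto simp: P_def\<close>)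
  also have "\<Omega> \<union> Mref ` P = \<Omega> \<union> Mref ` \<Omega>"
  proof -
    have "Mref n \<in> \<Omega> \<union> Mref ` P" if "n \<in> \<Omega>" for n
    proof (cases "snd n = 0")
      case True
      then have "Mref n = n" by (simp add: Mref_def prod_eq_iff)
      then show ?thesis using that by simp
    qed (use that in \<open>auto simp: P_def\<close>)
    moreover have "P \<subseteq> \<Omega>" by (auto simp: P_def)
    ultimately show ?thesis by blast
  qed
  finally show ?thesis by (simp add: Fpart_eq T_def)
qed

theorem theorem5p5:
  fixes k :: nat and \<alpha> :: real and f :: "real^3 \<Rightarrow> complex"
  assumes "k \<ge> 1" and "0 < \<alpha>" and "\<alpha> \<le> 1"
    and "Ckalpha_sphere k \<alpha> f"
  shows "((\<lambda>n. norm (fcoeff n (dfs f))) summable_on UNIV)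
    \<and> (\<forall>\<Omega>h :: nat \<Rightarrow> (int \<times> int) set.
           (\<forall>h. finite (\<Omega>h h)) \<and> (\<forall>h. \<Omega>h h \<subseteq> \<Omega>h (Suc h)) \<and> (\<Union>h. \<Omega>h h) = UNIV \<longrightarrow>
           uniform_limit UNIV (\<lambda>h. Fpart (\<Omega>h h) (dfs f)) (dfs f) sequentially)
    \<and> (\<forall>\<Omega> x. finite \<Omega> \<longrightarrow>
           norm (dfs f x - Fpart \<Omega> (dfs f) x) \<le> (\<Sum>\<^sub>\<infinity>n\<in>UNIV - \<Omega>. norm (fcoeff n (dfs f))))
    \<and> (\<forall>\<Omega>h :: nat \<Rightarrow> (int \<times> int) set.
           (\<forall>h. finite (\<Omega>h h)) \<and> (\<forall>h. \<Omega>h h \<subseteq> \<Omega>h (Suc h)) \<and> (\<Union>h. \<Omega>h h) = ZN0 \<longrightarrow>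
           uniform_limit S2 (\<lambda>h. Spart (\<Omega>h h) f) f sequentially)
    \<and> (\<forall>\<Omega> \<xi>. finite \<Omega> \<and> \<Omega> \<subseteq> ZN0 \<and> \<xi> \<in> S2 \<longrightarrow>
           norm (f \<xi> - Spart \<Omega> f \<xi>) \<le> (\<Sum>\<^sub>\<infinity>n\<in>UNIV - (\<Omega> \<union> Mref ` \<Omega>). norm (fcoeff n (dfs f))))"
proof -
  have approx: "trig_approx (dfs f)"
    by (rule trig_approx_dfs [OF Ckalpha_sphere_imp_continuous_on [OF assms]])
  have summable: "(\<lambda>n. norm (fcoeff n (dfs f))) summable_on UNIV"
  proof (rule dfs_second_difference [OF assms])
    fix \<beta> K assume \<beta>: "0 < \<beta>"
      and d1: "\<And>x t. 0 < t \<Longrightarrow> t \<le> 2 \<Longrightarrow> norm (dfs f (x + (t,0)) - 2 * dfs f x + dfs f (x - (t,0))) \<le> K * t powr (1 + \<beta>)"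
      and d2: "\<And>x t. 0 < t \<Longrightarrow> t \<le> 2 \<Longrightarrow> norm (dfs f (x + (0,t)) - 2 * dfs f x + dfs f (x - (0,t))) \<le> K * t powr (1 + \<beta>)"
    \<comment> \<open>The differences are controlled up to step 2, and
      \<open>fcoeff_summable\<close> uses steps up to \<open>pi/3\<close>.\<close>
    have "pi / 3 \<le> 2" using pi_less_4 by simp
    then show ?thesis
      by (intro fcoeff_summable [OF approx \<beta>, of K] d1 d2) auto
  qed
  have F: "norm (dfs f x - Fpart \<Omega> (dfs f) x) \<le> (\<Sum>\<^sub>\<infinity>n\<in>UNIV - \<Omega>. norm (fcoeff n (dfs f)))"
    if "finite \<Omega>" for \<Omega> x
    by (rule norm_diff_Fpart_le [OF approx summable that])
  have S: "norm (f \<xi> - Spart \<Omega> f \<xi>) \<le> (\<Sum>\<^sub>\<infinity>n\<in>UNIV - (\<Omega> \<union> Mref ` \<Omega>). norm (fcoeff n (dfs f)))"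
    if "finite \<Omega>" "\<Omega> \<subseteq> ZN0" "\<xi> \<in> S2" for \<Omega> \<xi>
    using F [of "\<Omega> \<union> Mref ` \<Omega>" "phi_inv \<xi>"] that
    by (simp add: Spart_eq_Fpart [OF approx] dfs_def phi_phi_inv del: mem_sphere_0)
  have limF: "uniform_limit UNIV (\<lambda>h. Fpart (\<Omega>h h) (dfs f)) (dfs f) sequentially"
    if "\<And>h. finite (\<Omega>h h)" "\<And>h. \<Omega>h h \<subseteq> \<Omega>h (Suc h)" "(\<Union>h. \<Omega>h h) = UNIV" for \<Omega>h
  proof (rule uniform_limitI)
    fix e :: real assume "e > 0"
    from infsum_tail_eventually_small [OF summable this that]
    show "\<forall>\<^sub>F h in sequentially. \<forall>x\<in>UNIV. dist (Fpart (\<Omega>h h) (dfs f) x) (dfs f x) < e"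
    proof eventually_elim
      case (elim h)
      then show ?case using F [OF that(1) [of h]] by (auto simp: dist_norm norm_minus_commute intro: le_less_trans)
    qed
  qed
  have limS: "uniform_limit S2 (\<lambda>h. Spart (\<Omega>h h) f) f sequentially"
    if fin: "\<And>h. finite (\<Omega>h h)" and inc: "\<And>h. \<Omega>h h \<subseteq> \<Omega>h (Suc h)" and ex: "(\<Union>h. \<Omega>h h) = ZN0" for \<Omega>h
  proof (rule uniform_limitI)
    fix e :: real assume "e > 0"
    \<comment> \<open>The symmetrised sets exhaust all of Z^2, so the tail estimate on the torus
      also serves the sphere.\<close>
    have "n \<in> (\<Union>h. \<Omega>h h \<union> Mref ` \<Omega>h h)" for n
    proof (cases "n \<in> ZN0")
      case True
      then show ?thesis using ex by blast
    next
      case False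
      then have "Mref n \<in> ZN0" "n = Mref (Mref n)" by (auto simp: ZN0_def Mref_def)
      then show ?thesis using ex by blast
    qed
    then have "(\<Union>h. \<Omega>h h \<union> Mref ` \<Omega>h h) = UNIV" by blast
    then have "\<forall>\<^sub>F h in sequentially. (\<Sum>\<^sub>\<infinity>n\<in>UNIV - (\<Omega>h h \<union> Mref ` \<Omega>h h). norm (fcoeff n (dfs f))) < e"
    proof (rule infsum_tail_eventually_small [OF summable \<open>e > 0\<close>, rotated 2])
      show "\<Omega>h h \<union> Mref ` \<Omega>h h \<subseteq> \<Omega>h (Suc h) \<union> Mref ` \<Omega>h (Suc h)" for h
        by (intro Un_mono image_mono inc)
    qed (use fin in auto)
    then show "\<forall>\<^sub>F h in sequentially. \<forall>\<xi>\<in>S2. dist (Spart (\<Omega>h h) f \<xi>) (f \<xi>) < e"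
    proof eventually_elim
      case (elim h)
      have "\<Omega>h h \<subseteq> ZN0" using ex by blast
      show ?case
      proof
        fix \<xi> :: "real^3" assume "\<xi> \<in> S2"
        from S [OF fin \<open>\<Omega>h h \<subseteq> ZN0\<close> this] elim show "dist (Spart (\<Omega>h h) f \<xi>) (f \<xi>) < e"
          by (simp add: dist_norm norm_minus_commute)
      qed
    qed
  qed
  show ?thesis
    using limF limS F S by (intro conjI summable) simp_all
qed

end
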